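(* For every $\varepsilon\in(0,1]$ there exists a positive integer $N_0(\varepsilon)$ such that the following holds: for every integer $N\geq N_0(\varepsilon)$ and every set $A\subseteq\{1,2,\ldots,N\}^2$ with density $\alpha:=|A|/N^2$ there exists a pair $(m,n)\in\mathbb{Z}^2\setminus\{(0,0)\}$ such that \[ \big| A \cap \big(A - (m,n)\big) \cap \big(A - (-n,m)\big) \big| \geq (\alpha^3 - \varepsilon)N^2, \] i.e., $A$ contains at least $(\alpha^3-\varepsilon)N^2$ triples of points of the form $(a,b),\ (a+m,b+n),\ (a-n,b+m)$ for this same fixed $(m,n)\neq(0,0)$.
   Context: For $A\subseteq\mathbb{Z}^2$ and $v\in\mathbb{Z}^2$, $A-v:=\{a-v : a\in A\}$. *)

theory Defs
  imports Complex_Main "HOL-Library.Product_Plus"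
begin

definition set_minus_vec :: "(int \<times> int) set \<Rightarrow> int \<times> int \<Rightarrow> (int \<times> int) set" where
  "set_minus_vec A v = (\<lambda>a. a - v) ` A"

definition grid_density :: "nat \<Rightarrow> (int \<times> int) set \<Rightarrow> real" where
  "grid_density N A = real (card A) / real N ^ 2"

lemma mem_set_minus_vec_iff: "p \<in> set_minus_vec A v \<longleftrightarrow> p + v \<in> A"
  unfolding set_minus_vec_def by (metis (no_types, lifting) add_diff_cancel diff_add_cancel image_iff)

text \<open>The size of the triple intersection is the number of triples
  \<open>(a, b), (a + m, b + n), (a - n, b + m)\<close> contained in \<open>A\<close>.\<close>

lemma card_translates_eq_card_triples:
  "card (A \<inter> set_minus_vec A (m, n) \<inter> set_minus_vec A (-n, m)) =
   card {((a, b), (a + m, b + n), (a - n, b + m)) | a b.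
     (a, b) \<in> A \<and> (a + m, b + n) \<in> A \<and> (a - n, b + m) \<in> A}"
proof -
  have "{((a, b), (a + m, b + n), (a - n, b + m)) | a b.
      (a, b) \<in> A \<and> (a + m, b + n) \<in> A \<and> (a - n, b + m) \<in> A} =
    (\<lambda>(a, b). ((a, b), (a + m, b + n), (a - n, b + m))) `
      (A \<inter> set_minus_vec A (m, n) \<inter> set_minus_vec A (-n, m))"
    by (auto simp: mem_set_minus_vec_iff image_iff)
  moreover have "inj_on (\<lambda>(a, b). ((a, b), (a + m, b + n), (a - n, b + m)))
      (A \<inter> set_minus_vec A (m, n) \<inter> set_minus_vec A (-n, m))"
    by (auto simp: inj_on_def)
  ultimately show ?thesis by (simp add: card_image)
qed

end

theory Submission
  imports Defs "HOL-Library.FuncSet"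
begin

text \<open>
  Identify the grid with \<open>(\<int>/N)\<^sup>2\<close> and let \<open>f\<close> be the indicator of \<open>A\<close>. The triangles
  \<open>x, x + d, x + id\<close> (with \<open>i\<close> the quarter turn) are counted with weight \<open>w(d)\<close>, where \<open>w\<close> is a
  nonnegative trigonometric polynomial of mean 1 with boundedly many frequencies. Three such
  kernels \<open>a, w, c\<close> are used: \<open>w\<close> is so concentrated that \<open>f * a\<close> hardly changes under
  translation by \<open>d\<close> or \<open>id\<close>, and \<open>c\<close> is so concentrated that every Fourier coefficient of
  \<open>f - f * c\<close> is tiny compared with the number of frequencies of \<open>w\<close>. The weighted count does not
  notice replacing \<open>f\<close> by \<open>f * c\<close>; iterating the construction, the pigeonhole principle provides
  a scale at which \<open>f * c\<close> and \<open>f * a\<close> are close in \<open>L\<^sup>2\<close>; and for \<open>f * a\<close> the count is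
  essentially the mean of \<open>(f * a)\<^sup>3\<close>, which is at least \<open>\<alpha>\<^sup>3\<close>. Since \<open>w\<close> is also concentrated
  on \<open>|d| \<le> \<delta>N\<close>, wrap-around modulo \<open>N\<close> costs only \<open>O(\<delta>)\<close>, and since it has boundedly many
  frequencies, it puts mass \<open>O(1/N\<^sup>2)\<close> on \<open>d = 0\<close>.
\<close>

declare split_paired_All [simp del] split_paired_Ex [simp del]

section \<open>Fourier analysis of periodic functions\<close>

locale torus =
  fixes N :: nat
  assumes N_pos: "0 < N"
begin

section \<open>The torus and functions periodic modulo \<open>N\<close>\<close>

definition Q :: "(int \<times> int) set" where
  "Q = {1..int N} \<times> {1..int N}"

definition red :: "int \<times> int \<Rightarrow> int \<times> int" where
  "red x = ((fst x - 1) mod int N + 1, (snd x - 1) mod int N + 1)"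

text \<open>Functions on the torus are kept as functions on all of \<open>int \<times> int\<close>,
  so that translation is plain addition. Representatives start at 1 to make a set in the grid
  literally a subset of \<open>Q\<close>; the class of 0 is then represented by
  \<open>(N, N)\<close>.\<close>

definition per :: "(int \<times> int \<Rightarrow> 'a) \<Rightarrow> bool" where
  "per f \<longleftrightarrow> (\<forall>x. f (red x) = f x)"

definition rot :: "int \<times> int \<Rightarrow> int \<times> int" where
  "rot x = (- snd x, fst x)"

lemma finite_Q [simp]: "finite Q" and card_Q: "card Q = N ^ 2"
  by (auto simp: Q_def power2_eq_square)

lemma red_in_Q [simp]: "red x \<in> Q"
proof -
  have "0 \<le> a mod int N" "a mod int N + 1 \<le> int N" for a
    using N_pos pos_mod_bound[of "int N" a] by (simp, linarith)
  then show ?thesis unfolding Q_def red_def by (simp add: add_increasing)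
qed

lemma red_id: "x \<in> Q \<Longrightarrow> red x = x"
  by (auto simp: Q_def red_def)

lemma red_red [simp]: "red (red x) = red x"
  by (simp add: red_id)

lemma red_eq_iff: "red x = red y \<longleftrightarrow> int N dvd fst x - fst y \<and> int N dvd snd x - snd y"
  by (simp add: red_def mod_eq_dvd_iff)

lemma red_eqI: "int N dvd fst x - fst y \<Longrightarrow> int N dvd snd x - snd y \<Longrightarrow> red x = red y"
  by (simp add: red_eq_iff)

lemma red_dvd: "int N dvd fst (red x) - fst x" "int N dvd snd (red x) - snd x"
  using red_red[of x] unfolding red_eq_iff by auto

lemma red_diff_eq_iff: "red (x - y) = red 0 \<longleftrightarrow> red x = red y"
  by (simp add: red_eq_iff)

lemma red_add_left [simp]: "red (red x + y) = red (x + y)"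
  using red_dvd[of x] by (intro red_eqI) auto

lemma red_add_right [simp]: "red (y + red x) = red (y + x)"
  using red_add_left[of x y] by (simp add: add.commute)

lemma red_diff_left [simp]: "red (red x - y) = red (x - y)"
  using red_dvd[of x] by (intro red_eqI) (auto simp: algebra_simps)

lemma red_rot [simp]: "red (rot (red x)) = red (rot x)"
  using red_dvd[of x] by (intro red_eqI) (auto simp: rot_def dvd_diff_commute)

lemma perD: "per f \<Longrightarrow> red x = red y \<Longrightarrow> f x = f y"
  by (metis per_def)

lemma per_red: "per f \<Longrightarrow> f (red x) = f x"
  by (simp only: per_def)

lemma per_comp: "per f \<Longrightarrow> (\<And>x. red (h (red x)) = red (h x)) \<Longrightarrow> per (\<lambda>x. f (h x))"
  by (auto simp: per_def intro: perD[unfolded per_def])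

lemma sum_reindex_le:
  fixes f :: "int \<times> int \<Rightarrow> real"
  assumes "per f" "\<And>x. 0 \<le> f x" "inj_on (\<lambda>x. red (h x)) P" "P \<subseteq> Q"
  shows "(\<Sum>x\<in>P. f (h x)) \<le> (\<Sum>x\<in>Q. f x)"
proof -
  have "(\<Sum>x\<in>P. f (h x)) = (\<Sum>x\<in>P. f (red (h x)))"
    using assms(1) by (simp add: per_red)
  also have "\<dots> = (\<Sum>x\<in>(\<lambda>x. red (h x)) ` P. f x)"
    using assms(3) by (simp add: sum.reindex)
  also have "\<dots> \<le> (\<Sum>x\<in>Q. f x)"
    using assms(2) by (intro sum_mono2) auto
  finally show ?thesis .
qed

lemma sum_reindex:
  fixes f :: "int \<times> int \<Rightarrow> 'a::comm_monoid_add"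
  assumes "per f" and inj: "\<And>x y. red (h x) = red (h y) \<Longrightarrow> red x = red y"
  shows "(\<Sum>x\<in>Q. f (h x)) = (\<Sum>x\<in>Q. f x)"
proof -
  have "inj_on (\<lambda>x. red (h x)) Q"
    by (rule inj_onI, drule inj) (simp add: red_id)
  then have "bij_betw (\<lambda>x. red (h x)) Q Q"
    by (simp add: bij_betw_def endo_inj_surj image_subset_iff)
  then have "(\<Sum>x\<in>Q. f (red (h x))) = (\<Sum>x\<in>Q. f x)"
    by (rule sum.reindex_bij_betw)
  then show ?thesis using assms(1) by (simp add: per_red)
qed

lemma sum_shift: "per f \<Longrightarrow> (\<Sum>x\<in>Q. f (x + d)) = (\<Sum>x\<in>Q. f x)"
  by (rule sum_reindex) (auto simp: red_eq_iff)

lemma sum_reflect: "per f \<Longrightarrow> (\<Sum>x\<in>Q. f (d - x)) = (\<Sum>x\<in>Q. f x)"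
  by (rule sum_reindex) (auto simp: red_eq_iff dvd_diff_commute)

lemma sum_rot: "per f \<Longrightarrow> (\<Sum>x\<in>Q. f (rot x)) = (\<Sum>x\<in>Q. f x)"
  by (rule sum_reindex) (auto simp: red_eq_iff rot_def dvd_diff_commute)

section \<open>Normalised averages over the torus\<close>

definition avg :: "(int \<times> int \<Rightarrow> 'a::real_normed_field) \<Rightarrow> 'a" where
  "avg f = (\<Sum>x\<in>Q. f x) / of_nat (N ^ 2)"

lemma avg_const [simp]: "avg (\<lambda>x. c) = c"
  using N_pos by (simp add: avg_def card_Q)

lemma avg_add: "avg (\<lambda>x. f x + g x) = avg f + avg g"
  by (simp add: avg_def sum.distrib add_divide_distrib)

lemma avg_diff: "avg (\<lambda>x. f x - g x) = avg f - avg g"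
  by (simp add: avg_def sum_subtractf diff_divide_distrib)

lemma avg_cmult: "avg (\<lambda>x. c * f x) = c * avg f"
  by (simp add: avg_def sum_distrib_left)

lemma avg_multc: "avg (\<lambda>x. f x * c) = avg f * c"
  by (simp add: avg_def sum_distrib_right)

lemma avg_sum: "avg (\<lambda>x. \<Sum>i\<in>I. f i x) = (\<Sum>i\<in>I. avg (f i))"
  unfolding avg_def by (subst sum.swap) (simp add: sum_divide_distrib)

lemma avg_swap: "avg (\<lambda>x. avg (\<lambda>y. f x y)) = avg (\<lambda>y. avg (\<lambda>x. f x y))"
  unfolding avg_def sum_divide_distrib[symmetric] by (subst sum.swap) simp

lemma avg_mono: "(\<And>x. x \<in> Q \<Longrightarrow> f x \<le> g x) \<Longrightarrow> avg f \<le> (avg g :: real)"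
  by (simp add: avg_def divide_right_mono sum_mono)

lemma avg_nonneg: "(\<And>x. x \<in> Q \<Longrightarrow> 0 \<le> f x) \<Longrightarrow> 0 \<le> (avg f :: real)"
  by (simp add: avg_def sum_nonneg)

lemma avg_cong: "(\<And>x. x \<in> Q \<Longrightarrow> f x = g x) \<Longrightarrow> avg f = avg g"
  by (simp add: avg_def)

lemma avg_of_real: "avg (\<lambda>x. complex_of_real (f x)) = of_real (avg f)"
  by (simp add: avg_def)

lemma avg_cnj: "cnj (avg f) = avg (\<lambda>x. cnj (f x))"
  by (simp add: avg_def)

lemma Re_avg: "Re (avg f) = avg (\<lambda>x. Re (f x))"
proof -
  have "Re z / real (N^2) = Re (z / of_nat (N^2))" for z
    by (metis Re_divide_of_nat)
  then show ?thesis unfolding avg_def by (simp only: Re_sum[symmetric] of_nat_id)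
qed

lemma norm_avg: "norm (avg f) \<le> avg (\<lambda>x. norm (f x))"
  unfolding avg_def by (simp add: norm_divide norm_power divide_right_mono norm_sum)

lemma avg_shift: "per f \<Longrightarrow> avg (\<lambda>x. f (x + d)) = avg f"
  by (simp add: avg_def sum_shift)

lemma avg_reflect: "per f \<Longrightarrow> avg (\<lambda>x. f (d - x)) = avg f"
  by (simp add: avg_def sum_reflect)

lemma avg_rot: "per f \<Longrightarrow> avg (\<lambda>x. f (rot x)) = avg f"
  by (simp add: avg_def sum_rot)

section \<open>Additive characters of the torus and their orthogonality\<close>

definition e :: "int \<times> int \<Rightarrow> int \<times> int \<Rightarrow> complex" where
  "e \<xi> x = cis (2 * pi * of_int (fst \<xi> * fst x + snd \<xi> * snd x) / N)"

lemma e_commute: "e \<xi> x = e x \<xi>"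
  by (simp add: e_def mult.commute)

lemma e_add_right: "e \<xi> (x + y) = e \<xi> x * e \<xi> y"
  by (simp add: e_def cis_mult) (simp add: field_simps add_divide_distrib)

lemma e_add_left: "e (\<xi> + \<zeta>) x = e \<xi> x * e \<zeta> x"
  using e_add_right e_commute by metis

lemma e_minus_right: "e \<xi> (- x) = cnj (e \<xi> x)"
proof -
  have "2 * pi * of_int (fst \<xi> * fst (- x) + snd \<xi> * snd (- x)) / N
      = - (2 * pi * of_int (fst \<xi> * fst x + snd \<xi> * snd x) / N)"
    using N_pos by (simp add: field_simps)
  then show ?thesis by (simp only: e_def cis_cnj)
qed

lemma e_minus_left: "e (- \<xi>) x = cnj (e \<xi> x)"
  using e_minus_right e_commute by metis

lemma e_diff_right: "e \<xi> (x - y) = e \<xi> x * cnj (e \<xi> y)"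
  using e_add_right[of \<xi> x "- y"] by (simp add: e_minus_right)

lemma e_diff_left: "e (\<xi> - \<zeta>) x = e \<xi> x * cnj (e \<zeta> x)"
  using e_diff_right e_commute by metis

lemma norm_e [simp]: "norm (e \<xi> x) = 1"
  by (simp add: e_def)

lemma e_cnj [simp]: "e \<xi> x * cnj (e \<xi> x) = 1" "cnj (e \<xi> x) * e \<xi> x = 1"
  using complex_norm_square[of "e \<xi> x"] by (auto simp: mult.commute)

lemma e_0 [simp]: "e 0 x = 1" "e x 0 = 1"
  by (auto simp: e_def)

text \<open>The transpose of a rotation is its inverse, here \<open>- rot\<close>. This is the
  source of the frequencies \<open>- rot \<xi>\<close> below.\<close>

lemma e_rot_right: "e \<xi> (rot x) = e (- rot \<xi>) x"
  by (simp add: e_def rot_def)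

lemma e_eq_1: assumes "red x = red 0" shows "e \<xi> x = 1"
proof -
  from assms obtain a b where "fst x = int N * a" "snd x = int N * b"
    by (auto simp: red_eq_iff elim!: dvdE)
  then have "2 * pi * of_int (fst \<xi> * fst x + snd \<xi> * snd x) / N
      = 2 * pi * of_int (fst \<xi> * a + snd \<xi> * b)"
    using N_pos by (simp add: field_simps)
  then show ?thesis
    using cis_multiple_2pi[of "of_int (fst \<xi> * a + snd \<xi> * b)"] by (simp only: e_def) simp
qed

lemma e_red_right: assumes "red x = red y" shows "e \<xi> x = e \<xi> y"
proof -
  have "red (x - y) = red 0" using assms by (simp add: red_diff_eq_iff)
  then have "e \<xi> (x - y + y) = e \<xi> y" using e_eq_1 by (simp only: e_add_right) simp
  then show ?thesis by simp
qed

lemma per_e_right: "per (e \<xi>)"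
  by (auto simp: per_def intro: e_red_right)

lemma per_e_left: "per (\<lambda>\<xi>. e \<xi> x)"
  using per_e_right[of x] by (simp add: e_commute[of _ x])

lemma cis_eq_1_dvd:
  assumes "cis (2 * pi * of_int k / N) = 1" shows "int N dvd k"
proof -
  have "cos (2 * pi * of_int k / N) = 1" using assms by (metis cis.sel(1) one_complex.sel(1))
  then obtain n :: int where "2 * pi * of_int k / N = of_int n * (2 * pi)"
    unfolding cos_one_2pi_int by auto
  then have "real_of_int k = of_int (n * int N)" using N_pos by (simp add: field_simps)
  then show ?thesis by (simp only: of_int_eq_iff) simp
qed

text \<open>Translation by \<open>d\<close> multiplies the average of a character by
  \<open>e \<xi> d\<close>, so the average vanishes unless the character is trivial; a nontrivial
  one already differs from 1 at one of the two unit vectors.\<close>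

lemma avg_e: "avg (e \<xi>) = of_bool (red \<xi> = red 0)"
proof (cases "red \<xi> = red 0")
  case True
  then have "e \<xi> = (\<lambda>_. 1)" using e_eq_1 e_commute by metis
  then show ?thesis using True by simp
next
  case False
  have "avg (e \<xi>) = avg (e \<xi>) * e \<xi> d" for d
    using avg_shift[OF per_e_right, of \<xi> d] by (simp add: e_add_right avg_multc)
  moreover obtain d where "e \<xi> d \<noteq> 1"
  proof -
    have "\<not> (e \<xi> (1,0) = 1 \<and> e \<xi> (0,1) = 1)"
      using False cis_eq_1_dvd by (auto simp: e_def red_eq_iff)
    then show ?thesis using that by blast
  qed
  ultimately have "avg (e \<xi>) = 0" by (metis mult_cancel_left1)
  then show ?thesis using False by simp
qed

lemma sum_e: "(\<Sum>\<xi>\<in>Q. e \<xi> x) = of_nat (N^2) * of_bool (red x = red 0)"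
  using avg_e[of x] N_pos by (simp add: avg_def e_commute[of _ x] field_simps)

lemma sum_delta_red:
  fixes f :: "int \<times> int \<Rightarrow> 'a::comm_semiring_1"
  assumes "per f"
  shows "(\<Sum>x\<in>Q. f x * of_bool (red x = red y)) = f y"
proof -
  have "(\<Sum>x\<in>Q. f x * of_bool (red x = red y)) = (\<Sum>x\<in>Q. if x = red y then f x else 0)"
    by (intro sum.cong) (auto simp: red_id)
  then show ?thesis using assms by (simp add: per_red)
qed

section \<open>The Fourier transform, with averages in space and sums in frequency\<close>

definition fhat :: "(int \<times> int \<Rightarrow> complex) \<Rightarrow> int \<times> int \<Rightarrow> complex" where
  "fhat f \<xi> = avg (\<lambda>x. f x * cnj (e \<xi> x))"

lemma per_fhat: "per (fhat f)"
  using per_red[OF per_e_left] by (simp add: per_def fhat_def)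

lemma inversion: assumes "per f" shows "(\<Sum>\<xi>\<in>Q. fhat f \<xi> * e \<xi> x) = f x"
proof -
  have "(\<Sum>\<xi>\<in>Q. fhat f \<xi> * e \<xi> x) = (\<Sum>\<xi>\<in>Q. avg (\<lambda>y. f y * e \<xi> (x - y)))"
    unfolding fhat_def avg_multc[symmetric] e_diff_right by (simp add: mult_ac)
  also have "\<dots> = avg (\<lambda>y. \<Sum>\<xi>\<in>Q. f y * e \<xi> (x - y))"
    by (simp add: avg_sum)
  also have "\<dots> = avg (\<lambda>y. f y * (of_nat (N^2) * of_bool (red y = red x)))"
    by (simp only: sum_distrib_left[symmetric] sum_e red_diff_eq_iff eq_commute[of "red x"])
  also have "\<dots> = (\<Sum>y\<in>Q. f y * of_bool (red y = red x))"
    unfolding avg_def mult.left_commute[of _ "of_nat (N^2)"] sum_distrib_left[symmetric]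
    using N_pos by simp
  finally show ?thesis by (simp only: sum_delta_red[OF assms])
qed

lemma parseval:
  assumes "per f"
  shows "(\<Sum>\<xi>\<in>Q. (norm (fhat f \<xi>))\<^sup>2) = avg (\<lambda>x. (norm (f x))\<^sup>2)"
proof -
  have "complex_of_real (\<Sum>\<xi>\<in>Q. (norm (fhat f \<xi>))\<^sup>2) = (\<Sum>\<xi>\<in>Q. fhat f \<xi> * cnj (fhat f \<xi>))"
    by (simp add: complex_norm_square del: of_real_power)
  also have "\<dots> = (\<Sum>\<xi>\<in>Q. avg (\<lambda>y. cnj (f y) * (fhat f \<xi> * e \<xi> y)))"
    by (simp add: fhat_def[of f] avg_cnj) (simp add: avg_cmult[symmetric] mult_ac)
  also have "\<dots> = avg (\<lambda>y. cnj (f y) * f y)"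
    by (simp add: avg_sum[symmetric] sum_distrib_left[symmetric] inversion[OF assms])
  also have "\<dots> = of_real (avg (\<lambda>x. (norm (f x))\<^sup>2))"
    by (simp add: avg_of_real[symmetric] complex_norm_square mult.commute del: of_real_power)
  finally show ?thesis using of_real_eq_iff by blast
qed

lemma fhat_shift:
  assumes "per f" shows "fhat (\<lambda>x. f (x + d)) \<xi> = e \<xi> d * fhat f \<xi>"
proof -
  have "per (\<lambda>x. f x * cnj (e \<xi> x))"
    using per_red[OF assms] per_red[OF per_e_right] by (simp add: per_def)
  from avg_shift[OF this, of d]
  have "fhat f \<xi> = avg (\<lambda>x. f (x + d) * cnj (e \<xi> x)) * cnj (e \<xi> d)"
    by (simp only: fhat_def e_add_right complex_cnj_mult avg_multc[symmetric] mult.assoc)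
  then show ?thesis by (simp add: fhat_def mult_ac)
qed

lemma fhat_modulate: "fhat (\<lambda>x. f x * e \<gamma> x) \<xi> = fhat f (\<xi> - \<gamma>)"
  by (simp add: fhat_def e_diff_left mult_ac)

lemma fhat_diff: "fhat (\<lambda>x. f x - g x) \<xi> = fhat f \<xi> - fhat g \<xi>"
  by (simp add: fhat_def avg_diff left_diff_distrib)

lemma norm_fhat_le: assumes "\<And>x. norm (f x) \<le> 1" shows "norm (fhat f \<xi>) \<le> 1"
proof -
  have "norm (fhat f \<xi>) \<le> avg (\<lambda>x. norm (f x))"
    unfolding fhat_def by (rule order_trans[OF norm_avg]) (simp add: norm_mult)
  also have "\<dots> \<le> avg (\<lambda>x. 1)" using assms by (intro avg_mono) auto
  finally show ?thesis by simp
qed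

end

section \<open>Counting with a kernel\<close>

context torus
begin

section \<open>The unweighted triangle count and its Fourier bound\<close>

definition tri :: "(int \<times> int \<Rightarrow> complex) \<Rightarrow> (int \<times> int \<Rightarrow> complex) \<Rightarrow> (int \<times> int \<Rightarrow> complex) \<Rightarrow> complex" where
  "tri F G H = avg (\<lambda>d. avg (\<lambda>x. F x * G (x + d) * H (x + rot d)))"

lemma per_mult: "per f \<Longrightarrow> per g \<Longrightarrow> per (\<lambda>x. f x * (g x :: 'a::times))"
  by (simp add: per_def)

lemma rot_minus_rot [simp]: "rot (- rot x) = x"
  by (simp add: rot_def)

lemma avg_rotated_translate:
  assumes "per H"
  shows "avg (\<lambda>d. e \<xi> d * H (x + rot d)) = e (- rot \<xi>) x * fhat H (- rot \<xi>)"
proof -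
  have p: "per (\<lambda>z. H (x + z))" using assms by (rule per_comp) simp
  have q: "e \<xi> d = cnj (e (- rot \<xi>) (rot d))" for d
    by (simp add: e_rot_right e_minus_left)
  have "avg (\<lambda>d. e \<xi> d * H (x + rot d))
      = avg (\<lambda>d. H (x + rot d) * cnj (e (- rot \<xi>) (rot d)))"
    by (simp only: q mult.commute)
  also have "\<dots> = avg (\<lambda>z. H (x + z) * cnj (e (- rot \<xi>) z))"
    using per_red[OF p] per_red[OF per_e_right] by (intro avg_rot) (simp add: per_def)
  also have "\<dots> = fhat (\<lambda>z. H (z + x)) (- rot \<xi>)"
    by (simp only: fhat_def add.commute)
  finally show ?thesis by (simp only: fhat_shift[OF assms])
qed

text \<open>Expanding \<open>G (x + d)\<close> into characters, the average over \<open>d\<close>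
  yields the coefficient of \<open>H\<close> at \<open>- rot \<xi>\<close>; the remaining phases in
  \<open>x\<close> combine to \<open>cnj (e (rot \<xi> - \<xi>) x)\<close>, and the average over
  \<open>x\<close> gives the coefficient of \<open>F\<close>.\<close>

lemma tri_fourier:
  assumes "per F" "per G" "per H"
  shows "tri F G H = (\<Sum>\<xi>\<in>Q. fhat G \<xi> * fhat H (- rot \<xi>) * fhat F (rot \<xi> - \<xi>))"
proof -
  have "tri F G H = avg (\<lambda>x. avg (\<lambda>d. F x * G (x + d) * H (x + rot d)))"
    unfolding tri_def by (rule avg_swap)
  also have "\<dots> = avg (\<lambda>x. \<Sum>\<xi>\<in>Q. fhat G \<xi> * fhat H (- rot \<xi>) * (F x * cnj (e (rot \<xi> - \<xi>) x)))"
  proof (rule avg_cong)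
    fix x
    have "avg (\<lambda>d. F x * G (x + d) * H (x + rot d))
        = avg (\<lambda>d. \<Sum>\<xi>\<in>Q. F x * (fhat G \<xi> * e \<xi> x) * (e \<xi> d * H (x + rot d)))"
      unfolding inversion[OF assms(2), of "x + _", symmetric]
      by (simp add: sum_distrib_left sum_distrib_right e_add_right mult_ac)
    also have "\<dots> = (\<Sum>\<xi>\<in>Q. F x * (fhat G \<xi> * e \<xi> x) * (e (- rot \<xi>) x * fhat H (- rot \<xi>)))"
      by (simp only: avg_sum avg_cmult avg_rotated_translate[OF assms(3)])
    also have "\<dots> = (\<Sum>\<xi>\<in>Q. fhat G \<xi> * fhat H (- rot \<xi>) * (F x * cnj (e (rot \<xi> - \<xi>) x)))"
      by (intro sum.cong refl) (simp add: e_diff_left e_minus_left mult_ac)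
    finally show "avg (\<lambda>d. F x * G (x + d) * H (x + rot d)) = \<dots>" .
  qed
  also have "\<dots> = (\<Sum>\<xi>\<in>Q. fhat G \<xi> * fhat H (- rot \<xi>) * fhat F (rot \<xi> - \<xi>))"
    by (simp only: avg_sum avg_cmult fhat_def)
  finally show ?thesis .
qed

text \<open>
  Multiplication by \<open>i - 1\<close> has determinant 2, so it is not injective modulo an even \<open>N\<close>; it is
  injective on each half of the torus, which costs a factor 2 in the bounds below.
\<close>

lemma inj_on_red_rot_diff:
  assumes "P \<subseteq> Q" "\<And>x y. x \<in> P \<Longrightarrow> y \<in> P \<Longrightarrow> 2 * \<bar>fst x - fst y\<bar> < int N"
  shows "inj_on (\<lambda>x. red (rot x - x)) P"
proof (rule inj_onI)
  fix x y assume xy: "x \<in> P" "y \<in> P" "red (rot x - x) = red (rot y - y)"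
  then have 1: "int N dvd (- snd x - fst x) - (- snd y - fst y)"
    and 2: "int N dvd (fst x - snd x) - (fst y - snd y)"
    by (auto simp: red_eq_iff rot_def)
  from dvd_diff[OF 2 1] have "int N dvd 2 * (fst x - fst y)"
    by (simp add: algebra_simps)
  moreover have "\<bar>2 * (fst x - fst y)\<bar> < int N" using assms(2)[OF xy(1,2)] by (simp only: abs_mult)
  ultimately have "fst x = fst y" 
    using dvd_imp_le_int[of "2 * (fst x - fst y)" "int N"] by (intro ccontr[of "fst x = fst y"]) simp
  with 2 have "red x = red y" by (simp add: red_eq_iff dvd_diff_commute)
  then show "x = y" using xy assms(1) by (metis red_id subsetD)
qed

lemma sum_fhat_sq:
  assumes "per X" "\<And>x. norm (X x) \<le> 1"
  shows "(\<Sum>\<xi>\<in>Q. (norm (fhat X \<xi>))\<^sup>2) \<le> 1"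
    and "(\<Sum>\<xi>\<in>Q. (norm (fhat X (- rot \<xi>)))\<^sup>2) \<le> 1"
    and "(\<Sum>\<xi>\<in>Q. (norm (fhat X (rot \<xi> - \<xi>)))\<^sup>2) \<le> 2"
proof -
  let ?g = "\<lambda>\<xi>. (norm (fhat X \<xi>))\<^sup>2"
  have per: "per ?g" using per_red[OF per_fhat] by (simp add: per_def)
  have "avg (\<lambda>x. (norm (X x))\<^sup>2) \<le> avg (\<lambda>x. 1)"
    using assms(2) by (intro avg_mono) (simp add: power_le_one)
  then show 1: "(\<Sum>\<xi>\<in>Q. ?g \<xi>) \<le> 1" by (simp add: parseval[OF assms(1)])
  have "(\<Sum>\<xi>\<in>Q. ?g (- rot \<xi>)) = (\<Sum>\<xi>\<in>Q. ?g \<xi>)"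
    by (rule sum_reindex[OF per]) (auto simp: red_eq_iff rot_def dvd_diff_commute)
  with 1 show "(\<Sum>\<xi>\<in>Q. ?g (- rot \<xi>)) \<le> 1" by simp
  \<comment> \<open>Within either half the first coordinates differ by less than
    \<open>N / 2\<close>, as \<open>inj_on_red_rot_diff\<close> requires; each half contributes at
    most 1.\<close>
  define P1 P2 where "P1 = {x\<in>Q. 2 * fst x \<le> int N}" and "P2 = {x\<in>Q. int N < 2 * fst x}"
  have "Q = P1 \<union> P2" "P1 \<inter> P2 = {}" "finite P1" "finite P2" by (auto simp: P1_def P2_def)
  then have "(\<Sum>\<xi>\<in>Q. ?g (rot \<xi> - \<xi>)) = (\<Sum>\<xi>\<in>P1. ?g (rot \<xi> - \<xi>)) + (\<Sum>\<xi>\<in>P2. ?g (rot \<xi> - \<xi>))"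
    by (simp only: sum.union_disjoint)
  also have "\<dots> \<le> (\<Sum>\<xi>\<in>Q. ?g \<xi>) + (\<Sum>\<xi>\<in>Q. ?g \<xi>)"
  proof (intro add_mono sum_reindex_le[OF per] inj_on_red_rot_diff)
    show "2 * \<bar>fst x - fst y\<bar> < int N" if "x \<in> P1" "y \<in> P1" for x y
      using that unfolding P1_def Q_def mem_Times_iff by simp arith
    show "2 * \<bar>fst x - fst y\<bar> < int N" if "x \<in> P2" "y \<in> P2" for x y
      using that unfolding P2_def Q_def mem_Times_iff by simp arith
  qed (auto simp: P1_def P2_def)
  finally show "(\<Sum>\<xi>\<in>Q. ?g (rot \<xi> - \<xi>)) \<le> 2" using 1 by simp
qed

text \<open>One factor is taken in sup norm and the other two in mean square, by AM-GM in place of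
  Cauchy-Schwarz. The constant 2 accommodates the map \<open>rot \<xi> - \<xi>\<close>, which can be
  two-to-one.\<close>

lemma sum_norm_mult_le:
  fixes u v w :: "'a \<Rightarrow> complex"
  assumes "\<And>i. i \<in> I \<Longrightarrow> norm (u i) \<le> \<kappa>" "0 \<le> \<kappa>"
    "(\<Sum>i\<in>I. (norm (v i))\<^sup>2) \<le> 2" "(\<Sum>i\<in>I. (norm (w i))\<^sup>2) \<le> 2"
  shows "norm (\<Sum>i\<in>I. u i * v i * w i) \<le> 2 * \<kappa>"
proof -
  have "norm (\<Sum>i\<in>I. u i * v i * w i) \<le> (\<Sum>i\<in>I. \<kappa> * (((norm (v i))\<^sup>2 + (norm (w i))\<^sup>2) / 2))"
  proof (rule sum_norm_le)
    fix i assume "i \<in> I"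
    have "norm (v i) * norm (w i) \<le> ((norm (v i))\<^sup>2 + (norm (w i))\<^sup>2) / 2"
      using sum_squares_bound[of "norm (v i)" "norm (w i)"] by simp
    then show "norm (u i * v i * w i) \<le> \<kappa> * (((norm (v i))\<^sup>2 + (norm (w i))\<^sup>2) / 2)"
      using assms(1)[OF \<open>i \<in> I\<close>] assms(2) by (simp add: norm_mult mult.assoc mult_mono)
  qed
  also have "\<dots> = \<kappa> * (((\<Sum>i\<in>I. (norm (v i))\<^sup>2) + (\<Sum>i\<in>I. (norm (w i))\<^sup>2)) / 2)"
    by (simp add: sum_distrib_left[symmetric] sum_divide_distrib[symmetric] sum.distrib)
  also have "\<dots> \<le> \<kappa> * 2" using assms by (intro mult_left_mono) auto
  finally show ?thesis by simp
qed

text \<open>A single function with small Fourier coefficients makes the whole count small: in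
  \<open>tri_fourier\<close> it is taken in sup norm, and Parseval controls the other two.\<close>

lemma norm_tri_le:
  assumes "per F" "per G" "per H"
    and "\<And>x. norm (F x) \<le> 1" "\<And>x. norm (G x) \<le> 1" "\<And>x. norm (H x) \<le> 1"
    and "(\<forall>\<xi>. norm (fhat F \<xi>) \<le> \<kappa>) \<or> (\<forall>\<xi>. norm (fhat G \<xi>) \<le> \<kappa>) \<or> (\<forall>\<xi>. norm (fhat H \<xi>) \<le> \<kappa>)"
  shows "norm (tri F G H) \<le> 2 * \<kappa>"
proof -
  have k: "0 \<le> \<kappa>" using assms(7) norm_ge_zero order_trans by blast
  note F = sum_fhat_sq[OF assms(1,4)] note G = sum_fhat_sq[OF assms(2,5)] note H = sum_fhat_sq[OF assms(3,6)]
  let ?f = "\<lambda>\<xi>. fhat F (rot \<xi> - \<xi>)" and ?g = "fhat G" and ?h = "\<lambda>\<xi>. fhat H (- rot \<xi>)"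
  have t: "tri F G H = (\<Sum>\<xi>\<in>Q. ?f \<xi> * ?g \<xi> * ?h \<xi>)" "tri F G H = (\<Sum>\<xi>\<in>Q. ?g \<xi> * ?f \<xi> * ?h \<xi>)"
    "tri F G H = (\<Sum>\<xi>\<in>Q. ?h \<xi> * ?g \<xi> * ?f \<xi>)"
    unfolding tri_fourier[OF assms(1-3)] by (simp_all add: mult_ac)
  from assms(7) show ?thesis
  proof (elim disjE)
    assume "\<forall>\<xi>. norm (fhat F \<xi>) \<le> \<kappa>"
    then show ?thesis unfolding t(1) using F G H k by (intro sum_norm_mult_le) simp_all
  next
    assume "\<forall>\<xi>. norm (fhat G \<xi>) \<le> \<kappa>"
    then show ?thesis unfolding t(2) using F G H k by (intro sum_norm_mult_le) simp_all
  next
    assume "\<forall>\<xi>. norm (fhat H \<xi>) \<le> \<kappa>"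
    then show ?thesis unfolding t(3) using F G H k by (intro sum_norm_mult_le) simp_all
  qed
qed

text \<open>
  A weight on differences is represented by its Fourier coefficients \<open>a\<close>; the weight itself is
  \<open>nu a\<close>.
\<close>

definition nu :: "(int \<times> int \<Rightarrow> real) \<Rightarrow> int \<times> int \<Rightarrow> real" where
  "nu a d = Re (\<Sum>\<xi>\<in>Q. of_real (a \<xi>) * e \<xi> d)"

definition supp :: "(int \<times> int \<Rightarrow> real) \<Rightarrow> (int \<times> int) set" where
  "supp a = {\<xi>\<in>Q. a \<xi> \<noteq> 0}"

text \<open>The value \<open>a 0 = 1\<close> normalises the weight to mean 1, so that
  \<open>nu a\<close> is a probability density on differences.\<close>

definition kernel :: "(int \<times> int \<Rightarrow> real) \<Rightarrow> bool" where
  "kernel a \<longleftrightarrow> per a \<and> a 0 = 1 \<and> (\<forall>\<xi>. 0 \<le> a \<xi> \<and> a \<xi> \<le> 1) \<and>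
     (\<forall>d. 0 \<le> nu a d \<and> (\<Sum>\<xi>\<in>Q. of_real (a \<xi>) * e \<xi> d) = of_real (nu a d))"

lemma kernelD:
  assumes "kernel a"
  shows "per a" "a 0 = 1" "0 \<le> a \<xi>" "a \<xi> \<le> 1" "0 \<le> nu a d"
    "of_real (nu a d) = (\<Sum>\<xi>\<in>Q. of_real (a \<xi>) * e \<xi> d)"
  using assms unfolding kernel_def by metis+

lemma finite_supp [simp]: "finite (supp a)"
  by (simp add: supp_def)

lemma sum_kernel_le:
  assumes "kernel a" shows "(\<Sum>\<xi>\<in>Q. a \<xi>) \<le> card (supp a)"
proof -
  have "(\<Sum>\<xi>\<in>Q. a \<xi>) = (\<Sum>\<xi>\<in>supp a. a \<xi>)"
    by (rule sum.mono_neutral_right) (auto simp: supp_def)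
  also have "\<dots> \<le> (\<Sum>\<xi>\<in>supp a. 1)" using kernelD[OF assms] by (intro sum_mono) auto
  finally show ?thesis by simp
qed

lemma per_nu: "per (nu a)"
  using per_red[OF per_e_right] by (simp add: per_def nu_def)

text \<open>Limits the degenerate difference: in an average over the torus, \<open>d = 0\<close>
  carries mass at most \<open>card (supp a) / N ^ 2\<close>.\<close>

lemma nu_0_le: "kernel a \<Longrightarrow> nu a 0 \<le> card (supp a)"
  using sum_kernel_le[of a] by (simp add: nu_def)

lemma fhat_nu:
  assumes "kernel a" shows "fhat (\<lambda>d. of_real (nu a d)) \<xi> = of_real (a \<xi>)"
proof -
  have p: "per (\<lambda>\<zeta>. complex_of_real (a \<zeta>))"
    using per_red[OF kernelD(1)[OF assms]] by (simp add: per_def)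
  have "fhat (\<lambda>d. of_real (nu a d)) \<xi> = avg (\<lambda>d. \<Sum>\<zeta>\<in>Q. of_real (a \<zeta>) * e (\<zeta> - \<xi>) d)"
    by (simp only: fhat_def kernelD(6)[OF assms] sum_distrib_right e_diff_left mult.assoc)
  also have "\<dots> = (\<Sum>\<zeta>\<in>Q. of_real (a \<zeta>) * of_bool (red \<zeta> = red \<xi>))"
    by (simp only: avg_sum avg_cmult avg_e red_diff_eq_iff)
  finally show ?thesis by (simp only: sum_delta_red[OF p])
qed

lemma avg_nu: assumes "kernel a" shows "avg (nu a) = 1"
  using fhat_nu[OF assms, of 0] kernelD(2)[OF assms]
  by (simp add: fhat_def avg_of_real)

text \<open>As \<open>e \<xi> d\<close> has modulus 1, its squared distance to 1 is
  \<open>2 - 2 * Re (e \<xi> d)\<close>, whose weighted average is read off from the coefficient at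
  \<open>\<xi>\<close>. A coefficient near 1 therefore concentrates the weight on those
  \<open>d\<close> with \<open>e \<xi> d\<close> near 1.\<close>

lemma avg_nu_dist:
  assumes "kernel a"
  shows "avg (\<lambda>d. nu a d * (norm (e \<xi> d - 1))\<^sup>2) = 2 - 2 * a \<xi>"
proof -
  have "nu a d * (norm (e \<xi> d - 1))\<^sup>2 = 2 * nu a d - 2 * Re (of_real (nu a d) * cnj (e \<xi> d))" for d
  proof -
    have "(Re (e \<xi> d))\<^sup>2 + (Im (e \<xi> d))\<^sup>2 = 1" using cmod_power2[of "e \<xi> d"] by simp
    then show ?thesis unfolding cmod_power2 by (simp add: power2_eq_square algebra_simps)
  qed
  then have "avg (\<lambda>d. nu a d * (norm (e \<xi> d - 1))\<^sup>2)
      = 2 * avg (nu a) - 2 * Re (fhat (\<lambda>d. of_real (nu a d)) \<xi>)"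
    by (simp only: avg_diff avg_cmult Re_avg fhat_def)
  then show ?thesis by (simp add: avg_nu fhat_nu assms)
qed

section \<open>The weighted triangle count\<close>

definition lam :: "(int \<times> int \<Rightarrow> real) \<Rightarrow> (int \<times> int \<Rightarrow> real) \<Rightarrow> (int \<times> int \<Rightarrow> real) \<Rightarrow> (int \<times> int \<Rightarrow> real) \<Rightarrow> real" where
  "lam a F G H = avg (\<lambda>d. nu a d * avg (\<lambda>x. F x * G (x + d) * H (x + rot d)))"

text \<open>Since \<open>e \<gamma> d = cnj (e \<gamma> x) * e \<gamma> (x + d)\<close>, each
  frequency of the weight is absorbed by modulating \<open>F\<close> and \<open>G\<close>.\<close>

lemma lam_eq_sum_tri:
  assumes "kernel a"
  shows "of_real (lam a F G H) = (\<Sum>\<gamma>\<in>Q. of_real (a \<gamma>) *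
    tri (\<lambda>x. of_real (F x) * e (- \<gamma>) x) (\<lambda>x. of_real (G x) * e \<gamma> x) (\<lambda>x. of_real (H x)))"
proof -
  have t: "tri (\<lambda>x. of_real (F x) * e (- \<gamma>) x) (\<lambda>x. of_real (G x) * e \<gamma> x) (\<lambda>x. of_real (H x))
      = avg (\<lambda>d. e \<gamma> d * of_real (avg (\<lambda>x. F x * G (x + d) * H (x + rot d))))" for \<gamma>
  proof -
    have "complex_of_real f * cnj E * (of_real g * (E * E')) * of_real h = E' * of_real (f * g * h)"
      if "E * cnj E = 1" for f g E E' h
      using that unfolding of_real_mult by algebra
    from this[OF e_cnj(1)] show ?thesis
      by (simp only: tri_def e_add_right e_minus_left avg_of_real[symmetric] avg_cmult[symmetric])
  qed
  have "of_real (lam a F G H) = avg (\<lambda>d. (\<Sum>\<gamma>\<in>Q. of_real (a \<gamma>) * e \<gamma> d)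
      * of_real (avg (\<lambda>x. F x * G (x + d) * H (x + rot d))))"
    by (simp add: lam_def avg_of_real[symmetric] kernelD(6)[OF assms])
  also have "\<dots> = (\<Sum>\<gamma>\<in>Q. of_real (a \<gamma>) * avg (\<lambda>d. e \<gamma> d
      * of_real (avg (\<lambda>x. F x * G (x + d) * H (x + rot d)))))"
    by (simp only: sum_distrib_right avg_sum mult.assoc avg_cmult)
  finally show ?thesis by (simp only: t)
qed

text \<open>Modulation merely translates Fourier coefficients (\<open>fhat_modulate\<close>), so
  \<open>norm_tri_le\<close> treats every frequency of the weight alike; the price is the number of
  frequencies.\<close>

lemma abs_lam_le:
  fixes \<kappa> :: real
  assumes "kernel a" "per F" "per G" "per H"
    and "\<And>x. \<bar>F x\<bar> \<le> 1" "\<And>x. \<bar>G x\<bar> \<le> 1" "\<And>x. \<bar>H x\<bar> \<le> 1"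
    and "(\<forall>\<xi>. norm (fhat (\<lambda>x. of_real (F x)) \<xi>) \<le> \<kappa>) \<or>
         (\<forall>\<xi>. norm (fhat (\<lambda>x. of_real (G x)) \<xi>) \<le> \<kappa>) \<or>
         (\<forall>\<xi>. norm (fhat (\<lambda>x. of_real (H x)) \<xi>) \<le> \<kappa>)"
  shows "\<bar>lam a F G H\<bar> \<le> card (supp a) * (2 * \<kappa>)"
proof -
  have k: "0 \<le> \<kappa>" using assms(8) norm_ge_zero order_trans by blast
  have "\<bar>lam a F G H\<bar> = norm (complex_of_real (lam a F G H))" by simp
  also have "\<dots> \<le> (\<Sum>\<gamma>\<in>Q. a \<gamma> * (2 * \<kappa>))"
    unfolding lam_eq_sum_tri[OF assms(1)]
  proof (rule sum_norm_le)
    fix \<gamma>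
    have "norm (tri (\<lambda>x. of_real (F x) * e (- \<gamma>) x) (\<lambda>x. of_real (G x) * e \<gamma> x) (\<lambda>x. of_real (H x))) \<le> 2 * \<kappa>"
      using assms(2-8) by (intro norm_tri_le per_mult per_e_right)
        (auto simp: per_def norm_mult fhat_modulate)
    then show "norm (of_real (a \<gamma>) * tri (\<lambda>x. of_real (F x) * e (- \<gamma>) x)
        (\<lambda>x. of_real (G x) * e \<gamma> x) (\<lambda>x. of_real (H x))) \<le> a \<gamma> * (2 * \<kappa>)"
      using kernelD(3)[OF assms(1)] by (simp add: norm_mult mult_left_mono)
  qed
  also have "\<dots> = (\<Sum>\<gamma>\<in>Q. a \<gamma>) * (2 * \<kappa>)" by (simp only: sum_distrib_right)
  also have "\<dots> \<le> card (supp a) * (2 * \<kappa>)"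
    using sum_kernel_le[OF assms(1)] k by (intro mult_right_mono) auto
  finally show ?thesis .
qed

end

section \<open>Existence of kernels\<close>

lemma exists_pow_less_exp:
  fixes \<eta> :: real assumes "0 < \<eta>"
  shows "\<exists>K. real ((K + 1) ^ s) < (1 + \<eta>) ^ K"
proof -
  \<comment> \<open>The exponent \<open>Suc s\<close> instead of \<open>s\<close> keeps the root
    meaningful for \<open>s = 0\<close>. It suffices to find \<open>K\<close> with
    \<open>K + 1 < y ^ K\<close> and to raise this to the power \<open>Suc s\<close>.\<close>
  define y where "y = root (Suc s) (1 + \<eta>)"
  have y: "1 < y" "y ^ Suc s = 1 + \<eta>"
    using assms real_root_gt_1_iff[of "Suc s" "1 + \<eta>"] by (auto simp: y_def simp del: power_Suc)
  have "(\<lambda>n. real n / y ^ n) \<longlonglongrightarrow> 0"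
    using lim_n_over_pown[of y] y(1) by simp
  \<comment> \<open>The threshold \<open>1 / y\<close> turns the inequality at index
    \<open>Suc K\<close> into \<open>K + 1 < y ^ K\<close>.\<close>
  then have "\<forall>\<^sub>F n in sequentially. real n / y ^ n < 1 / y"
    by (rule order_tendstoD) (use y in simp)
  then obtain K where "real (Suc K) / y ^ Suc K < 1 / y"
    unfolding eventually_sequentially by (meson le_SucI order_refl)
  then have "y * real (K + 1) < y * y ^ K" using y(1) by (simp add: field_simps)
  then have "real (K + 1) < y ^ K" using y(1) by simp
  then have "real (K + 1) ^ Suc s < (y ^ K) ^ Suc s" by (intro power_strict_mono) auto
  also have "\<dots> = (1 + \<eta>) ^ K" by (simp only: y(2)[symmetric] power_mult[symmetric] mult.commute)
  finally have "real (K + 1) ^ Suc s < (1 + \<eta>) ^ K" .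
  moreover have "real (K + 1) ^ s \<le> real (K + 1) ^ Suc s" by (intro power_increasing) auto
  ultimately have "real (K + 1) ^ s < (1 + \<eta>) ^ K" by (rule le_less_trans[rotated])
  then have "real ((K + 1) ^ s) < (1 + \<eta>) ^ K" by simp
  then show ?thesis by blast
qed

context torus
begin

text \<open>
  The weight is the Fejer-type kernel \<open>|\<Sum>\<^bsub>\<gamma> \<in> \<Gamma>\<^esub> e(\<gamma>, d)|\<^sup>2 / |\<Gamma>|\<close>; its coefficient at
  \<open>\<xi>\<close> is close to 1 when \<open>\<Gamma>\<close> is almost invariant under translation by \<open>\<xi>\<close>.
\<close>

lemma folner_kernel:
  assumes "\<Gamma> \<subseteq> Q" "\<Gamma> \<noteq> {}"
  defines "a \<equiv> \<lambda>\<xi>. real (card {\<gamma>\<in>\<Gamma>. red (\<gamma> + \<xi>) \<in> \<Gamma>}) / card \<Gamma>"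
  shows "kernel a" "card (supp a) \<le> (card \<Gamma>)\<^sup>2"
proof -
  have fin: "finite \<Gamma>" using assms(1) finite_subset finite_Q by blast
  then have c: "0 < card \<Gamma>" using assms(2) by (simp add: card_gt_0_iff)
  have "{\<gamma>\<in>\<Gamma>. red (\<gamma> + 0) \<in> \<Gamma>} = \<Gamma>" using assms(1) by (auto simp: red_id)
  then have a0: "a 0 = 1" using c by (simp add: a_def)
  have per: "per a" by (simp add: per_def a_def)
  have a01: "0 \<le> a \<xi>" "a \<xi> \<le> 1" for \<xi>
    using c card_mono[OF fin, of "{\<gamma>\<in>\<Gamma>. red (\<gamma> + \<xi>) \<in> \<Gamma>}"] by (auto simp: a_def)
  \<comment> \<open>The coefficients are the normalised autocorrelation of \<open>\<Gamma>\<close>,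
    so their Fourier sum is a square; this makes the weight nonnegative.\<close>
  have nu: "(\<Sum>\<xi>\<in>Q. of_real (a \<xi>) * e \<xi> d) = of_real ((norm (\<Sum>\<gamma>\<in>\<Gamma>. e \<gamma> d))\<^sup>2 / card \<Gamma>)" for d
  proof -
    have p: "per (\<lambda>\<xi>. of_bool (red \<xi> \<in> \<Gamma>) * (e \<xi> d * cnj (e \<gamma> d)))" for \<gamma>
      using per_red[OF per_e_left] by (simp add: per_def)
    have "(\<Sum>\<xi>\<in>Q. of_real (card {\<gamma>\<in>\<Gamma>. red (\<gamma> + \<xi>) \<in> \<Gamma>}) * e \<xi> d)
        = (\<Sum>\<xi>\<in>Q. \<Sum>\<gamma>\<in>\<Gamma>. of_bool (red (\<gamma> + \<xi>) \<in> \<Gamma>) * e \<xi> d)"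
      using fin by (simp add: Int_def flip: sum_distrib_right)
    also have "\<dots> = (\<Sum>\<gamma>\<in>\<Gamma>. \<Sum>\<xi>\<in>Q. of_bool (red (\<xi> + \<gamma>) \<in> \<Gamma>) * (e (\<xi> + \<gamma>) d * cnj (e \<gamma> d)))"
      by (subst sum.swap) (simp add: e_add_left add.commute mult.assoc)
    also have "\<dots> = (\<Sum>\<gamma>\<in>\<Gamma>. \<Sum>\<xi>\<in>Q. of_bool (red \<xi> \<in> \<Gamma>) * (e \<xi> d * cnj (e \<gamma> d)))"
      by (simp only: sum_shift[OF p])
    also have "\<dots> = (\<Sum>\<gamma>\<in>\<Gamma>. \<Sum>\<xi>\<in>\<Gamma>. e \<xi> d * cnj (e \<gamma> d))"
    proof (rule sum.cong[OF refl])
      fix \<gamma>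
      have "(\<Sum>\<xi>\<in>Q. of_bool (red \<xi> \<in> \<Gamma>) * (e \<xi> d * cnj (e \<gamma> d)))
          = (\<Sum>\<xi>\<in>Q. if \<xi> \<in> \<Gamma> then e \<xi> d * cnj (e \<gamma> d) else 0)"
        by (intro sum.cong) (auto simp: red_id)
      also have "\<dots> = (\<Sum>\<xi>\<in>Q \<inter> \<Gamma>. e \<xi> d * cnj (e \<gamma> d))"
        by (simp add: sum.inter_restrict)
      finally show "(\<Sum>\<xi>\<in>Q. of_bool (red \<xi> \<in> \<Gamma>) * (e \<xi> d * cnj (e \<gamma> d)))
          = (\<Sum>\<xi>\<in>\<Gamma>. e \<xi> d * cnj (e \<gamma> d))"
        using assms(1) by (simp add: inf_absorb2)
    qed
    also have "\<dots> = of_real ((norm (\<Sum>\<gamma>\<in>\<Gamma>. e \<gamma> d))\<^sup>2)"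
      unfolding complex_norm_square cnj_sum sum_product by (rule sum.swap)
    finally show ?thesis
      by (simp add: a_def sum_divide_distrib[symmetric])
  qed
  from nu have "nu a d = (norm (\<Sum>\<gamma>\<in>\<Gamma>. e \<gamma> d))\<^sup>2 / card \<Gamma>" for d
    unfolding nu_def by (simp only: Re_complex_of_real)
  with nu a0 per a01 show "kernel a" by (simp add: kernel_def)
  have "supp a \<subseteq> (\<lambda>(\<gamma>,\<gamma>'). red (\<gamma>' - \<gamma>)) ` (\<Gamma> \<times> \<Gamma>)"
  proof
    fix \<xi> assume "\<xi> \<in> supp a"
    then have xi: "\<xi> \<in> Q" and "card {\<gamma>\<in>\<Gamma>. red (\<gamma> + \<xi>) \<in> \<Gamma>} \<noteq> 0"
      by (auto simp: supp_def a_def)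
    then have "{\<gamma>\<in>\<Gamma>. red (\<gamma> + \<xi>) \<in> \<Gamma>} \<noteq> {}" by (metis card.empty)
    then obtain \<gamma> where g: "\<gamma> \<in> \<Gamma>" "red (\<gamma> + \<xi>) \<in> \<Gamma>" by blast
    have "\<xi> = red (red (\<gamma> + \<xi>) - \<gamma>)" using xi by (simp add: red_id)
    with g show "\<xi> \<in> (\<lambda>(\<gamma>,\<gamma>'). red (\<gamma>' - \<gamma>)) ` (\<Gamma> \<times> \<Gamma>)" by force
  qed
  then have "card (supp a) \<le> card (\<Gamma> \<times> \<Gamma>)" using fin by (intro surj_card_le) auto
  then show "card (supp a) \<le> (card \<Gamma>)\<^sup>2" by (simp add: power2_eq_square card_cartesian_product)
qed

section \<open>Almost invariant sets from generalised arithmetic progressions\<close>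

definition box_sums :: "(int \<times> int) set \<Rightarrow> nat \<Rightarrow> (int \<times> int) set" where
  "box_sums S k = (\<lambda>n. red (\<Sum>\<xi>\<in>S. (int (n \<xi>) * fst \<xi>, int (n \<xi>) * snd \<xi>))) ` (S \<rightarrow>\<^sub>E {0..k})"

lemma card_box_sums_le:
  assumes "finite S" shows "card (box_sums S k) \<le> (k + 1) ^ card S"
proof -
  have "finite (S \<rightarrow>\<^sub>E {0..k})" using assms by (intro finite_PiE) auto
  then have "card (box_sums S k) \<le> card (S \<rightarrow>\<^sub>E {0..k})"
    unfolding box_sums_def by (rule card_image_le)
  also have "\<dots> = (k + 1) ^ card S" using assms by (simp add: card_PiE)
  finally show ?thesis .
qed

lemma box_sums_subset: "box_sums S k \<subseteq> Q"
  by (auto simp: box_sums_def)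

lemma box_sums_nonempty: "box_sums S k \<noteq> {}"
  by (auto simp: box_sums_def PiE_eq_empty_iff)

lemma box_sums_mono: "box_sums S k \<subseteq> box_sums S (Suc k)"
  unfolding box_sums_def by (intro image_mono PiE_mono) auto

lemma box_sums_step:
  assumes "finite S" "\<xi> \<in> S" "\<gamma> \<in> box_sums S k"
  shows "red (\<gamma> + \<xi>) \<in> box_sums S (Suc k)"
proof -
  let ?s = "\<lambda>n. \<Sum>\<zeta>\<in>S. (int (n \<zeta>) * fst \<zeta>, int (n \<zeta>) * snd \<zeta>)"
  from assms(3) obtain n where n: "n \<in> S \<rightarrow>\<^sub>E {0..k}" "\<gamma> = red (?s n)"
    by (auto simp: box_sums_def)
  let ?n = "n(\<xi> := n \<xi> + 1)"
  have "?s ?n = (\<Sum>\<zeta>\<in>S. (int (n \<zeta>) * fst \<zeta>, int (n \<zeta>) * snd \<zeta>) + (if \<zeta> = \<xi> then \<xi> else 0))"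
    by (intro sum.cong refl) (auto simp: prod_eq_iff algebra_simps)
  also have "\<dots> = ?s n + \<xi>" using assms(1,2) by (simp add: sum.distrib)
  finally have "red (\<gamma> + \<xi>) = red (?s ?n)" using n(2) by simp
  moreover have "?n \<in> S \<rightarrow>\<^sub>E {0..Suc k}"
    using n(1) assms(2) by (auto simp: PiE_iff extensional_def)
  ultimately show ?thesis unfolding box_sums_def by blast
qed

text \<open>
  The boxes have polynomial growth, so one of boundedly many consecutive boxes grows by a factor
  of at most \<open>1 + \<eta>\<close>.
\<close>

lemma exists_folner:
  fixes \<eta> :: real
  assumes "finite S" "card S \<le> s" "0 < \<eta>" "real ((K + 1) ^ s) < (1 + \<eta>) ^ K"
  obtains \<Gamma> where "\<Gamma> \<subseteq> Q" "\<Gamma> \<noteq> {}" "card \<Gamma> \<le> (K + 1) ^ s"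
    "\<And>\<xi>. \<xi> \<in> S \<Longrightarrow> (1 - \<eta>) * card \<Gamma> \<le> card {\<gamma>\<in>\<Gamma>. red (\<gamma> + \<xi>) \<in> \<Gamma>}"
proof -
  let ?D = "box_sums S"
  have fin: "finite (?D k)" for k using box_sums_subset finite_subset finite_Q by blast
  have bound: "card (?D k) \<le> (K + 1) ^ s" if "k \<le> K" for k
  proof -
    have "(k + 1) ^ card S \<le> (K + 1) ^ card S" using that by (intro power_mono) auto
    also have "\<dots> \<le> (K + 1) ^ s" using assms(2) by (intro power_increasing) auto
    finally show ?thesis using card_box_sums_le[OF assms(1), of k] by simp
  qed
  obtain k where k: "k < K" "card (?D (Suc k)) \<le> (1 + \<eta>) * card (?D k)"
  proof (rule ccontr)
    assume "\<not> thesis"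
    with that have *: "(1 + \<eta>) * card (?D k) \<le> card (?D (Suc k))" if "k < K" for k
      using that by (meson less_eq_real_def not_le)
    have "(1 + \<eta>) ^ k \<le> card (?D k)" if "k \<le> K" for k
      using that
    proof (induction k)
      case 0
      have "card (?D 0) > 0" using fin box_sums_nonempty by (simp add: card_gt_0_iff)
      then show ?case by simp
    next
      case (Suc k)
      then have "(1 + \<eta>) * (1 + \<eta>) ^ k \<le> (1 + \<eta>) * card (?D k)"
        using assms(3) by (intro mult_left_mono) auto
      also have "\<dots> \<le> card (?D (Suc k))" using Suc.prems by (intro *) auto
      finally show ?case by simp
    qed
    from this[of K] bound[of K] assms(4) show False by linarith
  qed
  show thesis
  proof (rule that[of "?D k"])
    show "?D k \<subseteq> Q" "?D k \<noteq> {}" by (rule box_sums_subset, rule box_sums_nonempty)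
    show "card (?D k) \<le> (K + 1) ^ s" using bound k(1) by simp
    fix \<xi> assume xi: "\<xi> \<in> S"
    let ?h = "\<lambda>\<gamma>. red (\<gamma> + \<xi>)"
    have inj: "inj_on ?h (?D k)"
    proof (rule inj_onI)
      fix x y assume "x \<in> ?D k" "y \<in> ?D k" "?h x = ?h y"
      moreover from this have "red x = red y" by (simp add: red_eq_iff)
      ultimately show "x = y" using box_sums_subset by (metis red_id subsetD)
    qed
    \<comment> \<open>The box and its translate both lie in the next box, which has at most
      \<open>(1 + \<eta>) * card (?D k)\<close> points, so inclusion-exclusion forces the
      overlap.\<close>
    have "?D k \<union> ?h ` ?D k \<subseteq> ?D (Suc k)"
      using box_sums_mono box_sums_step[OF assms(1) xi] by blast
    then have "card (?D k \<union> ?h ` ?D k) \<le> card (?D (Suc k))" by (intro card_mono fin)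
    moreover have "card (?D k \<union> ?h ` ?D k) + card (?D k \<inter> ?h ` ?D k) = 2 * card (?D k)"
      using card_Un_Int[of "?D k" "?h ` ?D k"] fin inj by (simp add: card_image)
    moreover have "?D k \<inter> ?h ` ?D k = ?h ` {\<gamma>\<in>?D k. ?h \<gamma> \<in> ?D k}" by auto
    then have "card (?D k \<inter> ?h ` ?D k) = card {\<gamma>\<in>?D k. ?h \<gamma> \<in> ?D k}"
      using inj by (simp add: card_image inj_on_subset)
    ultimately show "(1 - \<eta>) * card (?D k) \<le> card {\<gamma>\<in>?D k. ?h \<gamma> \<in> ?D k}"
      using k(2) by (simp add: algebra_simps)
  qed
qed

end

text \<open>The bound \<open>C s \<eta>\<close> is fixed before \<open>N\<close> and
  \<open>S\<close>, which later allows a threshold for \<open>N\<close> depending on \<epsilon>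
  alone. The coefficient at \<open>\<xi>\<close> is the proportion of \<open>\<Gamma>\<close> that
  stays in \<open>\<Gamma>\<close> under translation by \<open>\<xi>\<close>, so the set from
  \<open>exists_folner\<close> serves.\<close>

lemma exists_kernel:
  "\<exists>C :: nat \<Rightarrow> real \<Rightarrow> nat. \<forall>s \<eta>. 0 < \<eta> \<longrightarrow> (\<forall>N S. 0 < N \<longrightarrow> finite S \<longrightarrow> card S \<le> s \<longrightarrow>
     (\<exists>a. torus.kernel N a \<and> card (torus.supp N a) \<le> C s \<eta> \<and> (\<forall>\<xi>\<in>S. 1 - \<eta> \<le> a \<xi>)))"
proof -
  have "\<exists>c::nat. 0 < \<eta> \<longrightarrow> (\<forall>N S. 0 < N \<longrightarrow> finite S \<longrightarrow> card S \<le> s \<longrightarrow>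
     (\<exists>a. torus.kernel N a \<and> card (torus.supp N a) \<le> c \<and> (\<forall>\<xi>\<in>S. 1 - \<eta> \<le> a \<xi>)))"
    for s :: nat and \<eta> :: real
  proof (cases "0 < \<eta>")
    case True
    then obtain K where K: "real ((K + 1) ^ s) < (1 + \<eta>) ^ K" using exists_pow_less_exp by blast
    have "\<exists>a. torus.kernel N a \<and> card (torus.supp N a) \<le> ((K + 1) ^ s)\<^sup>2 \<and> (\<forall>\<xi>\<in>S. 1 - \<eta> \<le> a \<xi>)"
      if *: "0 < N" "finite S" "card S \<le> s" for N S
    proof -
      interpret torus N by unfold_locales fact
      obtain \<Gamma> where G: "\<Gamma> \<subseteq> Q" "\<Gamma> \<noteq> {}" "card \<Gamma> \<le> (K + 1) ^ s"
        "\<And>\<xi>. \<xi> \<in> S \<Longrightarrow> (1 - \<eta>) * card \<Gamma> \<le> card {\<gamma>\<in>\<Gamma>. red (\<gamma> + \<xi>) \<in> \<Gamma>}"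
        using exists_folner[OF *(2,3) True K] by blast
      have "0 < card \<Gamma>" using G(1,2) finite_subset[OF _ finite_Q] by (auto simp: card_gt_0_iff)
      then have "1 - \<eta> \<le> real (card {\<gamma>\<in>\<Gamma>. red (\<gamma> + \<xi>) \<in> \<Gamma>}) / card \<Gamma>" if "\<xi> \<in> S" for \<xi>
        using G(4)[OF that] by (simp add: field_simps)
      moreover have "(card \<Gamma>)\<^sup>2 \<le> ((K + 1) ^ s)\<^sup>2" using G(3) by (intro power_mono) auto
      ultimately show ?thesis using folner_kernel[OF G(1,2)] order_trans by blast
    qed
    then show ?thesis by blast
  qed auto
  then show ?thesis by (intro choice allI)
qed

section \<open>The lower bound for the weighted count\<close>

text \<open>Passes from mean square to mean absolute bounds; \<open>\<tau>\<close> is later taken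
  comparable to the expected size of \<open>t\<close>.\<close>

lemma abs_le_amgm: fixes t \<tau> :: real assumes "0 < \<tau>" shows "\<bar>t\<bar> \<le> (\<tau> + t\<^sup>2 / \<tau>) / 2"
proof -
  have "0 \<le> (\<bar>t\<bar> - \<tau>)\<^sup>2" by simp
  then show ?thesis using assms by (simp add: power2_eq_square field_simps)
qed

lemma abs_prod3_diff_le:
  fixes a b c a' b' c' :: real
  assumes "0 \<le> a" "a \<le> 1" "0 \<le> b" "b \<le> 1" "0 \<le> c" "c \<le> 1"
    "0 \<le> a'" "a' \<le> 1" "0 \<le> b'" "b' \<le> 1" "0 \<le> c'" "c' \<le> 1"
  shows "\<bar>a * b * c - a' * b' * c'\<bar> \<le> \<bar>a - a'\<bar> + \<bar>b - b'\<bar> + \<bar>c - c'\<bar>"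
proof -
  have "a * b * c - a' * b' * c' = (a - a') * (b * c) + (b - b') * (a' * c) + (c - c') * (a' * b')"
    by algebra
  moreover have "\<bar>u * (p * q)\<bar> \<le> \<bar>u\<bar>" if "0 \<le> p" "p \<le> 1" "0 \<le> q" "q \<le> 1" for u p q :: real
    using that mult_left_le[of "p * q" "\<bar>u\<bar>"] mult_le_one[of p q] by (simp add: abs_mult)
  then have "\<bar>(a - a') * (b * c)\<bar> \<le> \<bar>a - a'\<bar>" "\<bar>(b - b') * (a' * c)\<bar> \<le> \<bar>b - b'\<bar>"
    "\<bar>(c - c') * (a' * b')\<bar> \<le> \<bar>c - c'\<bar>" using assms by blast+
  ultimately show ?thesis by linarith
qed

context torus
begin

section \<open>Smoothing, that is, convolution with a weight\<close>

definition smooth :: "(int \<times> int \<Rightarrow> real) \<Rightarrow> (int \<times> int \<Rightarrow> real) \<Rightarrow> int \<times> int \<Rightarrow> real" where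
  "smooth a f x = avg (\<lambda>y. f y * nu a (x - y))"

abbreviation rhat :: "(int \<times> int \<Rightarrow> real) \<Rightarrow> int \<times> int \<Rightarrow> complex" where
  "rhat f \<equiv> fhat (\<lambda>x. complex_of_real (f x))"

lemma per_of_real: "per f \<Longrightarrow> per (\<lambda>x. complex_of_real (f x))"
  by (simp add: per_def)

lemma per_smooth: "per (smooth a f)"
proof -
  have "nu a (red x - y) = nu a (x - y)" for x y by (rule perD[OF per_nu]) simp
  then show ?thesis by (simp add: per_def smooth_def)
qed

lemma fhat_smooth:
  assumes "kernel a" shows "rhat (smooth a f) \<xi> = of_real (a \<xi>) * rhat f \<xi>"
proof -
  have p: "per (\<lambda>\<zeta>. complex_of_real (a \<zeta>) * rhat f \<zeta>)"
    using per_red[OF kernelD(1)[OF assms]] per_red[OF per_fhat] by (simp add: per_def)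
  have "complex_of_real (smooth a f x) = (\<Sum>\<zeta>\<in>Q. of_real (a \<zeta>) * rhat f \<zeta> * e \<zeta> x)" for x
  proof -
    have "complex_of_real (smooth a f x)
        = avg (\<lambda>y. \<Sum>\<zeta>\<in>Q. (of_real (a \<zeta>) * e \<zeta> x) * (of_real (f y) * cnj (e \<zeta> y)))"
      by (simp add: smooth_def avg_of_real[symmetric] kernelD(6)[OF assms] sum_distrib_left
          e_diff_right mult_ac)
    then show ?thesis
      by (simp only: avg_sum avg_cmult fhat_def) (simp add: mult_ac)
  qed
  then have "rhat (smooth a f) \<xi>
      = avg (\<lambda>x. \<Sum>\<zeta>\<in>Q. (of_real (a \<zeta>) * rhat f \<zeta>) * e (\<zeta> - \<xi>) x)"
    by (simp only: fhat_def[of _ \<xi>] sum_distrib_right e_diff_left mult.assoc)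
  also have "\<dots> = (\<Sum>\<zeta>\<in>Q. (of_real (a \<zeta>) * rhat f \<zeta>) * of_bool (red \<zeta> = red \<xi>))"
    by (simp only: avg_sum avg_cmult avg_e red_diff_eq_iff)
  finally show ?thesis by (simp only: sum_delta_red[OF p])
qed

lemma smooth_bounds:
  assumes "kernel a" "\<And>x. 0 \<le> f x" "\<And>x. f x \<le> 1"
  shows "0 \<le> smooth a f x" "smooth a f x \<le> 1"
proof -
  show "0 \<le> smooth a f x"
    unfolding smooth_def by (intro avg_nonneg mult_nonneg_nonneg kernelD(5) assms)
  have "smooth a f x \<le> avg (\<lambda>y. nu a (x - y))"
    unfolding smooth_def using assms kernelD(5)[OF assms(1)]
    by (intro avg_mono) (simp add: mult_left_le_one_le)
  then show "smooth a f x \<le> 1" by (simp add: avg_reflect[OF per_nu] avg_nu[OF assms(1)])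
qed

lemma avg_smooth: assumes "kernel a" shows "avg (smooth a f) = avg f"
  using fhat_smooth[OF assms, of f 0] kernelD(2)[OF assms] by (simp add: fhat_def avg_of_real)

lemma parseval_real: "per f \<Longrightarrow> avg (\<lambda>x. (f x)\<^sup>2) = (\<Sum>\<xi>\<in>Q. (norm (rhat f \<xi>))\<^sup>2)"
  using parseval[OF per_of_real, of f] by simp

lemma energy_smooth_diff:
  assumes "kernel a" "kernel c"
  shows "avg (\<lambda>x. (smooth c f x - smooth a f x)\<^sup>2) = (\<Sum>\<xi>\<in>Q. (norm (rhat f \<xi>))\<^sup>2 * (c \<xi> - a \<xi>)\<^sup>2)"
proof -
  have p: "per (\<lambda>x. smooth c f x - smooth a f x)"
    using per_red[OF per_smooth] by (simp add: per_def)
  have "rhat (\<lambda>x. smooth c f x - smooth a f x) \<xi> = of_real (c \<xi> - a \<xi>) * rhat f \<xi>" for \<xi>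
    using fhat_diff[of "\<lambda>x. of_real (smooth c f x)" "\<lambda>x. of_real (smooth a f x)" \<xi>]
    by (simp add: fhat_smooth assms left_diff_distrib)
  then show ?thesis unfolding parseval_real[OF p] by (simp add: norm_mult power_mult_distrib mult.commute del: of_real_diff)
qed

text \<open>The pair \<open>h\<close>, \<open>k\<close> covers both translations at once: the
  identity with itself, and \<open>rot\<close> with its transpose \<open>- rot\<close>. Parseval in
  \<open>x\<close> turns the translation into factors \<open>e (k \<xi>) d - 1\<close>, which
  \<open>avg_nu_dist\<close> averages over \<open>d\<close>.\<close>

lemma energy_shift:
  assumes "kernel w" "per g" and h: "\<And>\<xi> d. e \<xi> (h d) = e (k \<xi>) d"
  shows "avg (\<lambda>d. nu w d * avg (\<lambda>x. (g (x + h d) - g x)\<^sup>2))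
    = (\<Sum>\<xi>\<in>Q. (norm (rhat g \<xi>))\<^sup>2 * (2 - 2 * w (k \<xi>)))"
proof -
  have "avg (\<lambda>x. (g (x + h d) - g x)\<^sup>2) = (\<Sum>\<xi>\<in>Q. (norm (rhat g \<xi>))\<^sup>2 * (norm (e (k \<xi>) d - 1))\<^sup>2)" for d
  proof -
    have "per (\<lambda>x. g (x + h d))" using assms(2) by (rule per_comp) simp
    then have p: "per (\<lambda>x. g (x + h d) - g x)"
      using per_red[OF assms(2)] by (simp add: per_def)
    have "rhat (\<lambda>x. g (x + h d) - g x) \<xi> = rhat g \<xi> * (e (k \<xi>) d - 1)" for \<xi>
      using fhat_diff[of "\<lambda>x. of_real (g (x + h d))" "\<lambda>x. of_real (g x)" \<xi>]
        fhat_shift[OF per_of_real[OF assms(2)], of "h d" \<xi>]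
      by (simp add: h algebra_simps)
    then show ?thesis unfolding parseval_real[OF p] by (simp add: norm_mult power_mult_distrib)
  qed
  then have "avg (\<lambda>d. nu w d * avg (\<lambda>x. (g (x + h d) - g x)\<^sup>2))
      = avg (\<lambda>d. \<Sum>\<xi>\<in>Q. (norm (rhat g \<xi>))\<^sup>2 * (nu w d * (norm (e (k \<xi>) d - 1))\<^sup>2))"
    by (simp add: sum_distrib_left mult_ac)
  then show ?thesis by (simp only: avg_sum avg_cmult avg_nu_dist[OF assms(1)])
qed

text \<open>Smoothing leaves only frequencies in \<open>supp a\<close>, where
  \<open>w (k \<xi>)\<close> is close to 1, so the mean square change is at most
  \<open>2 * \<theta>\<^sup>2\<close>; AM-GM with \<open>\<tau> = \<theta>\<close> converts
  this.\<close>

lemma avg_shift_smooth_le: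
  assumes "kernel a" "kernel w" "per f" "\<And>x. \<bar>f x\<bar> \<le> 1" "0 < \<theta>"
    and h: "\<And>\<xi> d. e \<xi> (h d) = e (k \<xi>) d"
    and w: "\<And>\<xi>. \<xi> \<in> supp a \<Longrightarrow> 1 - \<theta>\<^sup>2 \<le> w (k \<xi>)"
  shows "avg (\<lambda>d. nu w d * avg (\<lambda>x. \<bar>smooth a f (x + h d) - smooth a f x\<bar>)) \<le> 2 * \<theta>"
proof -
  let ?g = "smooth a f"
  have "avg (\<lambda>d. nu w d * avg (\<lambda>x. (?g (x + h d) - ?g x)\<^sup>2))
      = (\<Sum>\<xi>\<in>Q. (norm (rhat f \<xi>))\<^sup>2 * ((a \<xi>)\<^sup>2 * (2 - 2 * w (k \<xi>))))"
    unfolding energy_shift[where h = h and k = k, OF assms(2) per_smooth h] fhat_smooth[OF assms(1)]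
    by (simp add: norm_mult power_mult_distrib mult_ac)
  also have "\<dots> \<le> (\<Sum>\<xi>\<in>Q. (norm (rhat f \<xi>))\<^sup>2 * (2 * \<theta>\<^sup>2))"
  proof (intro sum_mono mult_left_mono)
    fix \<xi> assume "\<xi> \<in> Q"
    show "(a \<xi>)\<^sup>2 * (2 - 2 * w (k \<xi>)) \<le> 2 * \<theta>\<^sup>2"
    proof (cases "a \<xi> = 0")
      case False
      with \<open>\<xi> \<in> Q\<close> w have "1 - \<theta>\<^sup>2 \<le> w (k \<xi>)" by (simp add: supp_def)
      moreover have "(a \<xi>)\<^sup>2 \<le> 1" using kernelD[OF assms(1)] by (simp add: power_le_one)
      then have "(a \<xi>)\<^sup>2 * (2 - 2 * w (k \<xi>)) \<le> 1 * (2 - 2 * w (k \<xi>))"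
        using kernelD(4)[OF assms(2)] by (intro mult_right_mono) auto
      ultimately show ?thesis by simp
    qed simp
  qed simp
  also have "\<dots> = (\<Sum>\<xi>\<in>Q. (norm (rhat f \<xi>))\<^sup>2) * (2 * \<theta>\<^sup>2)" by (simp only: sum_distrib_right)
  also have "\<dots> \<le> 1 * (2 * \<theta>\<^sup>2)"
    using sum_fhat_sq(1)[OF per_of_real[OF assms(3)]] assms(4) by (intro mult_right_mono) auto
  finally have M: "avg (\<lambda>d. nu w d * avg (\<lambda>x. (?g (x + h d) - ?g x)\<^sup>2)) \<le> 2 * \<theta>\<^sup>2" by simp
  have "avg (\<lambda>d. nu w d * avg (\<lambda>x. \<bar>?g (x + h d) - ?g x\<bar>))
      \<le> avg (\<lambda>d. nu w d * avg (\<lambda>x. (\<theta> + (?g (x + h d) - ?g x)\<^sup>2 / \<theta>) / 2))"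
    using kernelD(5)[OF assms(2)] abs_le_amgm[OF assms(5)]
    by (intro avg_mono mult_left_mono) auto
  also have "\<dots> = avg (\<lambda>d. \<theta> / 2 * nu w d + 1 / (2 * \<theta>) * (nu w d * avg (\<lambda>x. (?g (x + h d) - ?g x)\<^sup>2)))"
  proof (rule avg_cong)
    fix d
    have "avg (\<lambda>x. (\<theta> + (?g (x + h d) - ?g x)\<^sup>2 / \<theta>) / 2)
        = avg (\<lambda>x. \<theta> / 2 + 1 / (2 * \<theta>) * (?g (x + h d) - ?g x)\<^sup>2)"
      by (rule avg_cong) (simp add: field_simps)
    then show "nu w d * avg (\<lambda>x. (\<theta> + (?g (x + h d) - ?g x)\<^sup>2 / \<theta>) / 2)
      = \<theta> / 2 * nu w d + 1 / (2 * \<theta>) * (nu w d * avg (\<lambda>x. (?g (x + h d) - ?g x)\<^sup>2))"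
      by (simp only: avg_add avg_cmult avg_const) (simp add: algebra_simps)
  qed
  also have "\<dots> = \<theta> / 2 + 1 / (2 * \<theta>) * avg (\<lambda>d. nu w d * avg (\<lambda>x. (?g (x + h d) - ?g x)\<^sup>2))"
    by (simp only: avg_add avg_cmult avg_nu[OF assms(2)] mult_1_right)
  also have "\<dots> \<le> \<theta> / 2 + 1 / (2 * \<theta>) * (2 * \<theta>\<^sup>2)"
    using M assms(5) by (intro add_left_mono mult_left_mono) auto
  also have "\<dots> \<le> 2 * \<theta>" using assms(5) by (simp add: power2_eq_square)
  finally show ?thesis .
qed

text \<open>For nonnegative arguments the cube lies above its tangent at the mean \<open>m\<close>,
  because \<open>t ^ 3 - 3 * m\<^sup>2 * t + 2 * m ^ 3 = (t - m)\<^sup>2 * (t + 2 *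
  m)\<close>.\<close>

lemma cube_avg_le:
  assumes "\<And>x. 0 \<le> g x" shows "(avg g) ^ 3 \<le> avg (\<lambda>x. (g x :: real) ^ 3)"
proof -
  let ?m = "avg g"
  have m: "0 \<le> ?m" using assms by (intro avg_nonneg)
  have "avg (\<lambda>x. 3 * ?m\<^sup>2 * g x - 2 * ?m ^ 3) \<le> avg (\<lambda>x. (g x) ^ 3)"
  proof (rule avg_mono)
    fix x
    have "0 \<le> (g x - ?m)\<^sup>2 * (g x + 2 * ?m)" using assms[of x] m by simp
    also have "\<dots> = (g x) ^ 3 - (3 * ?m\<^sup>2 * g x - 2 * ?m ^ 3)" by algebra
    finally show "3 * ?m\<^sup>2 * g x - 2 * ?m ^ 3 \<le> (g x) ^ 3" by simp
  qed
  then show ?thesis by (simp add: avg_diff avg_cmult power2_eq_square power3_eq_cube)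
qed

lemma avg_nu_const: "kernel w \<Longrightarrow> avg (\<lambda>d. nu w d * c) = c"
  by (simp add: avg_multc avg_nu)

lemma lam_cube_ge:
  assumes "kernel w" "per g" "\<And>x. 0 \<le> g x" "\<And>x. g x \<le> 1"
  shows "(avg g) ^ 3 - avg (\<lambda>d. nu w d * avg (\<lambda>x. \<bar>g (x + d) - g x\<bar>))
    - avg (\<lambda>d. nu w d * avg (\<lambda>x. \<bar>g (x + rot d) - g x\<bar>)) \<le> lam w g g g"
proof -
  have "avg (\<lambda>d. nu w d * (avg g) ^ 3 - nu w d * avg (\<lambda>x. \<bar>g (x + d) - g x\<bar>)
      - nu w d * avg (\<lambda>x. \<bar>g (x + rot d) - g x\<bar>)) \<le> lam w g g g"
    unfolding lam_def
  proof (rule avg_mono)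
    fix d
    have "(avg g) ^ 3 - avg (\<lambda>x. \<bar>g (x + d) - g x\<bar>) - avg (\<lambda>x. \<bar>g (x + rot d) - g x\<bar>)
        \<le> avg (\<lambda>x. (g x) ^ 3 - \<bar>g (x + d) - g x\<bar> - \<bar>g (x + rot d) - g x\<bar>)"
      unfolding avg_diff using cube_avg_le[of g] assms(3) by simp
    also have "\<dots> \<le> avg (\<lambda>x. g x * g (x + d) * g (x + rot d))"
    proof (rule avg_mono)
      fix x
      show "(g x) ^ 3 - \<bar>g (x + d) - g x\<bar> - \<bar>g (x + rot d) - g x\<bar> \<le> g x * g (x + d) * g (x + rot d)"
        using abs_prod3_diff_le[of "g x" "g (x + d)" "g (x + rot d)" "g x" "g x" "g x"] assms(3,4)
        by (simp add: power3_eq_cube)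
    qed
    finally show "nu w d * (avg g) ^ 3 - nu w d * avg (\<lambda>x. \<bar>g (x + d) - g x\<bar>)
        - nu w d * avg (\<lambda>x. \<bar>g (x + rot d) - g x\<bar>)
      \<le> nu w d * avg (\<lambda>x. g x * g (x + d) * g (x + rot d))"
      using kernelD(5)[OF assms(1)] by (simp only: right_diff_distrib[symmetric] mult_left_mono)
  qed
  then show ?thesis by (simp only: avg_diff avg_nu_const[OF assms(1)])
qed

text \<open>By translation invariance each of the three factors costs the same mean distance,
  whatever \<open>d\<close> is, and the weight has mean 1.\<close>

lemma lam_L1:
  assumes "kernel w" "per g" "\<And>x. 0 \<le> g x" "\<And>x. g x \<le> 1" "per f" "\<And>x. 0 \<le> f x" "\<And>x. f x \<le> 1"
  shows "lam w g g g - 3 * avg (\<lambda>x. \<bar>f x - g x\<bar>) \<le> lam w f f f"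
proof -
  let ?v = "\<lambda>x. \<bar>f x - g x\<bar>"
  have v: "per ?v" using per_red[OF assms(2)] per_red[OF assms(5)] by (simp add: per_def)
  have "avg (\<lambda>d. nu w d * avg (\<lambda>x. g x * g (x + d) * g (x + rot d)) - nu w d * (3 * avg ?v)) \<le> lam w f f f"
    unfolding lam_def
  proof (rule avg_mono)
    fix d
    have "avg (\<lambda>x. g x * g (x + d) * g (x + rot d)) - 3 * avg ?v
        = avg (\<lambda>x. g x * g (x + d) * g (x + rot d) - (?v x + ?v (x + d) + ?v (x + rot d)))"
      unfolding avg_diff avg_add avg_shift[OF v] by simp
    also have "\<dots> \<le> avg (\<lambda>x. f x * f (x + d) * f (x + rot d))"
    proof (rule avg_mono)
      fix x
      show "g x * g (x + d) * g (x + rot d) - (?v x + ?v (x + d) + ?v (x + rot d)) \<le> f x * f (x + d) * f (x + rot d)"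
        using abs_prod3_diff_le[of "f x" "f (x + d)" "f (x + rot d)" "g x" "g (x + d)" "g (x + rot d)"]
          assms(3,4,6,7) by (simp add: abs_le_iff)
    qed
    finally show "nu w d * avg (\<lambda>x. g x * g (x + d) * g (x + rot d)) - nu w d * (3 * avg ?v)
        \<le> nu w d * avg (\<lambda>x. f x * f (x + d) * f (x + rot d))"
      using kernelD(5)[OF assms(1)] by (simp only: right_diff_distrib[symmetric] mult_left_mono)
  qed
  then show ?thesis unfolding avg_diff avg_nu_const[OF assms(1)] by (simp add: lam_def)
qed

lemma lam_telescope:
  "lam w f f f - lam w g g g
    = lam w (\<lambda>x. f x - g x) f f + lam w g (\<lambda>x. f x - g x) f + lam w g g (\<lambda>x. f x - g x)"
  unfolding lam_def avg_diff[symmetric] avg_add[symmetric] right_diff_distrib[symmetric]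
    distrib_left[symmetric]
  by (simp add: algebra_simps)

lemma red_0_in_supp: "kernel w \<Longrightarrow> red 0 \<in> supp w"
  using kernelD(1,2)[of w] per_red[of w 0] by (simp add: supp_def)

text \<open>The error is \<open>6 * \<theta>\<close> for replacing \<open>f\<close> by
  \<open>smooth c f\<close>, \<open>6 * \<theta>\<close> for replacing that by
  \<open>smooth a f\<close>, and \<open>4 * \<theta>\<close> for undoing the two translations. The
  thresholds are divided by \<open>b\<close> because \<open>abs_lam_le\<close> loses the number of
  frequencies of \<open>w\<close>.\<close>

proposition lam_lower_bound:
  fixes b :: real
  assumes ker: "kernel a" "kernel w" "kernel c"
    and f: "per f" "\<And>x. 0 \<le> f x" "\<And>x. f x \<le> 1"
    and \<theta>: "0 < \<theta>" "\<theta> \<le> 1"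
    and b: "card (supp w) \<le> b"
    and w: "\<And>\<xi>. \<xi> \<in> supp a \<Longrightarrow> 1 - \<theta>\<^sup>2 \<le> w \<xi>" "\<And>\<xi>. \<xi> \<in> supp a \<Longrightarrow> 1 - \<theta>\<^sup>2 \<le> w (- rot \<xi>)"
    and c: "\<And>\<xi>. \<xi> \<in> Q \<Longrightarrow> \<theta>\<^sup>2 / b \<le> norm (rhat f \<xi>) \<Longrightarrow> 1 - \<theta>\<^sup>2 / b \<le> c \<xi>"
    and en: "avg (\<lambda>x. (smooth c f x - smooth a f x)\<^sup>2) \<le> 4 * \<theta>\<^sup>2"
  shows "(avg f) ^ 3 - 16 * \<theta> \<le> lam w f f f"
proof -
  let ?g = "smooth a f" and ?h = "smooth c f" and ?u = "\<lambda>x. f x - smooth c f x"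
  have af: "\<bar>f x\<bar> \<le> 1" for x using f(2,3)[of x] by simp
  note g = smooth_bounds[where f = f, OF ker(1) f(2,3)]
    and h = smooth_bounds[where f = f, OF ker(3) f(2,3)]
  have ah: "\<bar>?h x\<bar> \<le> 1" for x using h[of x] by simp
  have au: "\<bar>?u x\<bar> \<le> 1" for x using h[of x] f(2,3)[of x] by simp
  have pu: "per ?u" using per_red[OF f(1)] per_red[OF per_smooth] by (simp add: per_def)
  have "card (supp w) > 0" using red_0_in_supp[OF ker(2)] by (auto simp: card_gt_0_iff)
  then have b0: "b > 0" using b by linarith
  have uhat: "norm (rhat ?u \<xi>) \<le> \<theta>\<^sup>2 / b" for \<xi>
  proof -
    have eq: "rhat ?u \<xi> = of_real (1 - c \<xi>) * rhat f \<xi>" for \<xi>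
      using fhat_diff[of "\<lambda>x. of_real (f x)" "\<lambda>x. of_real (?h x)" \<xi>]
      by (simp add: fhat_smooth ker algebra_simps)
    have c01: "0 \<le> 1 - c \<xi>" "1 - c \<xi> \<le> 1" for \<xi> using kernelD(3,4)[OF ker(3), of \<xi>] by auto
    have f1: "norm (rhat f \<xi>) \<le> 1" for \<xi> using af by (intro norm_fhat_le) simp
    \<comment> \<open>The assumption on \<open>c\<close> speaks of \<open>Q\<close> only, hence the
      representative. There either the coefficient of \<open>f\<close> is small or
      \<open>1 - c ?r\<close> is.\<close>
    let ?r = "red \<xi>"
    have "norm (rhat ?u ?r) = (1 - c ?r) * norm (rhat f ?r)"
      unfolding eq norm_mult norm_of_real using c01 by simp
    also have "\<dots> \<le> \<theta>\<^sup>2 / b"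
    proof (cases "\<theta>\<^sup>2 / b \<le> norm (rhat f ?r)")
      case True
      have "(1 - c ?r) * norm (rhat f ?r) \<le> (1 - c ?r) * 1"
        using c01 f1 by (intro mult_left_mono) auto
      then show ?thesis using c[OF red_in_Q True] by simp
    next
      case False
      have "(1 - c ?r) * norm (rhat f ?r) \<le> 1 * norm (rhat f ?r)"
        using c01 by (intro mult_right_mono) auto
      then show ?thesis using False by simp
    qed
    finally show ?thesis by (simp add: per_red[OF per_fhat])
  qed
  have "card (supp w) * (2 * (\<theta>\<^sup>2 / b)) \<le> b * (2 * (\<theta>\<^sup>2 / b))"
    using b b0 by (intro mult_right_mono) auto
  also have "\<dots> = 2 * \<theta>\<^sup>2" using b0 by simp
  also have "\<dots> \<le> 2 * \<theta>" using \<theta> by (simp add: power2_eq_square mult_left_le_one_le)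
  finally have small: "card (supp w) * (2 * (\<theta>\<^sup>2 / b)) \<le> 2 * \<theta>" .
  \<comment> \<open>These are the three terms of \<open>lam_telescope\<close>; in each,
    \<open>?u\<close> supplies the small Fourier coefficients.\<close>
  have t: "\<bar>lam w ?u f f\<bar> \<le> 2 * \<theta>" "\<bar>lam w ?h ?u f\<bar> \<le> 2 * \<theta>" "\<bar>lam w ?h ?h ?u\<bar> \<le> 2 * \<theta>"
    using uhat af ah au by (auto intro!: order_trans[OF abs_lam_le small] ker f pu per_smooth)
  have 1: "lam w ?h ?h ?h - 6 * \<theta> \<le> lam w f f f"
    using lam_telescope[of w f ?h] t by linarith
  \<comment> \<open>AM-GM with \<open>\<tau> = 2 * \<theta>\<close>, adapted to the energy bound
    \<open>4 * \<theta>\<^sup>2\<close>.\<close>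
  have "avg (\<lambda>x. \<bar>?h x - ?g x\<bar>) \<le> avg (\<lambda>x. \<theta> + 1 / (4 * \<theta>) * (?h x - ?g x)\<^sup>2)"
    using abs_le_amgm[of "2 * \<theta>" "?h x - ?g x" for x] \<theta> by (intro avg_mono) (simp add: field_simps)
  also have "\<dots> = \<theta> + 1 / (4 * \<theta>) * avg (\<lambda>x. (?h x - ?g x)\<^sup>2)" by (simp only: avg_add avg_cmult avg_const)
  also have "\<dots> \<le> \<theta> + 1 / (4 * \<theta>) * (4 * \<theta>\<^sup>2)"
    using en \<theta> by (intro add_left_mono mult_left_mono) auto
  also have "\<dots> = 2 * \<theta>" using \<theta> by (simp add: power2_eq_square)
  finally have 2: "lam w ?g ?g ?g - 6 * \<theta> \<le> lam w ?h ?h ?h"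
    using lam_L1[OF ker(2) per_smooth g per_smooth h] by linarith
  have "avg (\<lambda>d. nu w d * avg (\<lambda>x. \<bar>?g (x + d) - ?g x\<bar>)) \<le> 2 * \<theta>"
    by (rule avg_shift_smooth_le[where h = "\<lambda>d. d" and k = "\<lambda>\<xi>. \<xi>", OF ker(1,2) f(1) af \<theta>(1) refl w(1)])
  moreover have "avg (\<lambda>d. nu w d * avg (\<lambda>x. \<bar>?g (x + rot d) - ?g x\<bar>)) \<le> 2 * \<theta>"
    by (rule avg_shift_smooth_le[where h = rot and k = "\<lambda>\<xi>. - rot \<xi>", OF ker(1,2) f(1) af \<theta>(1) e_rot_right w(2)])
  ultimately have "(avg f) ^ 3 - 4 * \<theta> \<le> lam w ?g ?g ?g"
    using lam_cube_ge[OF ker(2) per_smooth g] by (simp add: avg_smooth[OF ker(1)])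
  with 1 2 show ?thesis by linarith
qed

end

section \<open>Choosing the scale\<close>

text \<open>Since \<open>y ^ 3 \<le> 4 * y\<close> on this interval, the cubic Taylor remainder
  takes away at most two thirds of \<open>y\<close>.\<close>

lemma third_le_sin:
  fixes y :: real assumes "0 \<le> y" "y \<le> 2" shows "y / 3 \<le> sin y"
proof -
  have "\<bar>sin y - y\<bar> \<le> y ^ 3 / 6"
  proof -
    have "(\<Sum>m<3. sin_coeff m * y ^ m) = y" by (simp add: numeral_3_eq_3 sin_coeff_def)
    then show ?thesis using Maclaurin_sin_bound[of y 3] assms(1) by (simp add: fact_numeral)
  qed
  moreover have "y ^ 3 \<le> 4 * y"
  proof -
    have "y * y \<le> 2 * 2" using assms by (intro mult_mono) auto
    then have "(y * y) * y \<le> 4 * y" using assms(1) by (intro mult_right_mono) auto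
    then show ?thesis by (simp add: power3_eq_cube)
  qed
  ultimately show ?thesis by linarith
qed

text \<open>The chord has length \<open>2 * sin (pi * \<bar>t\<bar>)\<close>; the crude bounds
  \<open>2 \<le> pi\<close> and \<open>pi < 4\<close> bring it within reach of
  \<open>third_le_sin\<close>. Later this makes a character value near 1 force a short
  representative.\<close>

lemma norm_cis_minus_1_ge:
  fixes t :: real assumes "\<bar>t\<bar> \<le> 1 / 2"
  shows "t\<^sup>2 \<le> (norm (cis (2 * pi * t) - 1))\<^sup>2"
proof -
  have "pi * \<bar>t\<bar> \<le> pi * (1 / 2)" using assms by (intro mult_left_mono) auto
  then have y: "0 \<le> pi * \<bar>t\<bar>" "pi * \<bar>t\<bar> \<le> 2" using pi_less_4 by (simp, linarith)
  have "2 * \<bar>t\<bar> \<le> pi * \<bar>t\<bar>" using pi_ge_two by (intro mult_right_mono) auto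
  then have "\<bar>t\<bar> \<le> 2 * sin (pi * \<bar>t\<bar>)" using third_le_sin[OF y] by linarith
  then have "\<bar>t\<bar>\<^sup>2 \<le> (2 * sin (pi * \<bar>t\<bar>))\<^sup>2" by (intro power_mono) auto
  also have "\<dots> = 2 - 2 * cos (2 * (pi * t))"
    unfolding cos_double_sin by (cases "0 \<le> t") (auto simp: power_mult_distrib)
  also have "\<dots> = (norm (cis (2 * pi * t) - 1))\<^sup>2"
    using sin_cos_squared_add[of "2 * pi * t"] unfolding cmod_power2
    by (simp add: power2_eq_square algebra_simps)
  finally show ?thesis by simp
qed

text \<open>From \<open>x = 0\<close> there is no decrease to \<open>y\<close>; otherwise
  \<open>1 - \<eta> \<le> y\<close> limits the decrease to \<open>\<eta>\<close>, so the absolute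
  difference exceeds the signed one by at most \<open>2 * \<eta>\<close>.\<close>

lemma sq_diff_le:
  fixes x y \<eta> :: real
  assumes "0 \<le> x" "x \<le> 1" "0 \<le> y" "y \<le> 1" "x \<noteq> 0 \<Longrightarrow> 1 - \<eta> \<le> y" "0 \<le> \<eta>"
  shows "(y - x)\<^sup>2 \<le> y - x + 2 * \<eta>"
proof -
  have "\<bar>y - x\<bar> * \<bar>y - x\<bar> \<le> 1 * \<bar>y - x\<bar>" using assms by (intro mult_right_mono) auto
  then have "(y - x)\<^sup>2 \<le> \<bar>y - x\<bar>" by (simp add: power2_eq_square)
  then show ?thesis using assms by (cases "x = 0") linarith+
qed

context torus
begin

text \<open>
  Up to an error \<open>2\<eta>\<close> the squares \<open>(a\<^bsub>k+2\<^esub> - a\<^bsub>k\<^esub>)\<^sup>2\<close> are bounded by the differences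
  \<open>a\<^bsub>k+2\<^esub> - a\<^bsub>k\<^esub>\<close>, whose sum over \<open>k\<close> telescopes.
\<close>

lemma small_increment:
  fixes a :: "nat \<Rightarrow> int \<times> int \<Rightarrow> real"
  assumes ker: "\<And>k. kernel (a k)"
    and next_ge: "\<And>k \<xi>. \<xi> \<in> supp (a k) \<Longrightarrow> 1 - \<eta> \<le> a (Suc k) \<xi>"
    and \<eta>: "0 < \<eta>" "\<eta> < 1" and f: "per f" "\<And>x. \<bar>f x\<bar> \<le> 1" and K: "0 < K" "1 \<le> \<eta> * real K"
  shows "\<exists>k<K. avg (\<lambda>x. (smooth (a (Suc (Suc k))) f x - smooth (a k) f x)\<^sup>2) \<le> 4 * \<eta>"
proof (rule ccontr)
  let ?en = "\<lambda>k. avg (\<lambda>x. (smooth (a (Suc (Suc k))) f x - smooth (a k) f x)\<^sup>2)"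
  assume "\<not> ?thesis"
  then have "4 * \<eta> < ?en k" if "k < K" for k using that by (meson not_le)
  then have "(\<Sum>k<K. 4 * \<eta>) < (\<Sum>k<K. ?en k)" using K(1) by (intro sum_strict_mono) auto
  also have "(\<Sum>k<K. ?en k) = (\<Sum>\<xi>\<in>Q. (norm (rhat f \<xi>))\<^sup>2 * (\<Sum>k<K. (a (Suc (Suc k)) \<xi> - a k \<xi>)\<^sup>2))"
    unfolding energy_smooth_diff[OF ker ker] sum_distrib_left by (rule sum.swap)
  also have "\<dots> \<le> (\<Sum>\<xi>\<in>Q. (norm (rhat f \<xi>))\<^sup>2 * (2 + 2 * \<eta> * real K))"
  proof (intro sum_mono mult_left_mono)
    fix \<xi> assume xi: "\<xi> \<in> Q"
    have "(\<Sum>k<K. (a (Suc (Suc k)) \<xi> - a k \<xi>)\<^sup>2) \<le> (\<Sum>k<K. a (Suc (Suc k)) \<xi> - a k \<xi> + 2 * \<eta>)"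
    proof (intro sum_mono sq_diff_le)
      fix k assume "a k \<xi> \<noteq> 0"
      with xi have "1 - \<eta> \<le> a (Suc k) \<xi>" by (intro next_ge) (simp add: supp_def)
      \<comment> \<open>As \<open>\<eta> < 1\<close>, the bound just obtained puts
        \<open>\<xi>\<close> into the support of \<open>a (Suc k)\<close>, so the next kernel is
        near 1 there as well.\<close>
      with xi \<eta> show "1 - \<eta> \<le> a (Suc (Suc k)) \<xi>" by (intro next_ge) (simp add: supp_def)
    qed (use kernelD(3,4)[OF ker] \<eta> in auto)
    also have "\<dots> = (\<Sum>k<K. a (Suc (Suc k)) \<xi> - a k \<xi>) + 2 * \<eta> * real K"
      by (simp add: sum.distrib)
    \<comment> \<open>Steps of length two telescope to two terms at either end.\<close>
    also have "(\<Sum>k<K. a (Suc (Suc k)) \<xi> - a k \<xi>) = a K \<xi> + a (Suc K) \<xi> - a 0 \<xi> - a 1 \<xi>"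
      by (induction K) auto
    also have "\<dots> \<le> 2"
      using kernelD(3)[OF ker, of 0 \<xi>] kernelD(3)[OF ker, of 1 \<xi>]
        kernelD(4)[OF ker, of K \<xi>] kernelD(4)[OF ker, of "Suc K" \<xi>] by linarith
    finally show "(\<Sum>k<K. (a (Suc (Suc k)) \<xi> - a k \<xi>)\<^sup>2) \<le> 2 + 2 * \<eta> * real K" by simp
  qed simp
  also have "\<dots> = (\<Sum>\<xi>\<in>Q. (norm (rhat f \<xi>))\<^sup>2) * (2 + 2 * \<eta> * real K)"
    by (simp only: sum_distrib_right)
  also have "\<dots> \<le> 1 * (2 + 2 * \<eta> * real K)"
    using sum_fhat_sq(1)[OF per_of_real[OF f(1)]] f(2) \<eta> by (intro mult_right_mono) auto
  \<comment> \<open>Now \<open>4 * \<eta> * K < 2 + 2 * \<eta> * K\<close>, against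
    \<open>1 \<le> \<eta> * K\<close>.\<close>
  finally show False using K(2) by (simp add: algebra_simps)
qed

text \<open>Chebyshev's inequality combined with Parseval.\<close>

lemma card_large_spectrum_le:
  fixes \<kappa> :: real
  assumes "per f" "\<And>x. \<bar>f x\<bar> \<le> 1" "0 < \<kappa>"
  shows "card {\<xi>\<in>Q. \<kappa> \<le> norm (rhat f \<xi>)} \<le> 1 / \<kappa>\<^sup>2"
proof -
  let ?S = "{\<xi>\<in>Q. \<kappa> \<le> norm (rhat f \<xi>)}"
  have "card ?S * \<kappa>\<^sup>2 = (\<Sum>\<xi>\<in>?S. \<kappa>\<^sup>2)" by simp
  also have "\<dots> \<le> (\<Sum>\<xi>\<in>?S. (norm (rhat f \<xi>))\<^sup>2)"
    using assms(3) by (intro sum_mono power_mono) auto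
  also have "\<dots> \<le> (\<Sum>\<xi>\<in>Q. (norm (rhat f \<xi>))\<^sup>2)" by (intro sum_mono2) auto
  also have "\<dots> \<le> 1" using sum_fhat_sq(1)[OF per_of_real[OF assms(1)]] assms(2) by simp
  finally show ?thesis using assms(3) by (simp add: field_simps)
qed

end

text \<open>Bounds the number of frequencies at each scale independently of the torus and of
  \<open>f\<close>. The first argument of \<open>C\<close> counts the support of the previous kernel
  and its rotated image, the two unit vectors, and the large spectrum of \<open>f\<close>.\<close>

primrec support_bound :: "(nat \<Rightarrow> real \<Rightarrow> nat) \<Rightarrow> real \<Rightarrow> nat \<Rightarrow> nat" where
  "support_bound C \<eta> 0 = C 0 1"
| "support_bound C \<eta> (Suc k) =
    C (2 * support_bound C \<eta> k + 2 + nat \<lfloor>1 / (\<eta> / support_bound C \<eta> k)\<^sup>2\<rfloor>) (\<eta> / support_bound C \<eta> k)"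

context torus
begin

text \<open>Dependent choice: each kernel is built for the support of its predecessor, so that three
  consecutive ones fit \<open>lam_lower_bound\<close>. The unit vectors are included to concentrate
  the weight near \<open>d = 0\<close>.\<close>

lemma exists_kernel_sequence:
  fixes C :: "nat \<Rightarrow> real \<Rightarrow> nat"
  defines "b \<equiv> support_bound C"
  assumes C: "\<forall>s \<eta>. 0 < \<eta> \<longrightarrow> (\<forall>S. finite S \<longrightarrow> card S \<le> s \<longrightarrow>
      (\<exists>a. kernel a \<and> card (supp a) \<le> C s \<eta> \<and> (\<forall>\<xi>\<in>S. 1 - \<eta> \<le> a \<xi>)))"
    and f: "per f" "\<And>x. \<bar>f x\<bar> \<le> 1" and \<eta>: "0 < \<eta>"
  obtains a where "\<And>k. kernel (a k)" "\<And>k. card (supp (a k)) \<le> b \<eta> k"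
    "\<And>k \<xi>. \<xi> \<in> supp (a k) \<Longrightarrow> 1 - \<eta> \<le> a (Suc k) \<xi>"
    "\<And>k \<xi>. \<xi> \<in> supp (a k) \<Longrightarrow> 1 - \<eta> \<le> a (Suc k) (- rot \<xi>)"
    "\<And>k. 1 - \<eta> \<le> a (Suc k) (1, 0)" "\<And>k. 1 - \<eta> \<le> a (Suc k) (0, 1)"
    "\<And>k \<xi>. \<xi> \<in> Q \<Longrightarrow> \<eta> / b \<eta> k \<le> norm (rhat f \<xi>) \<Longrightarrow> 1 - \<eta> / b \<eta> k \<le> a (Suc k) \<xi>"
proof -
  define S where "S k a = supp a \<union> (\<lambda>\<xi>. - rot \<xi>) ` supp a \<union> {(1, 0), (0, 1)} \<union>
    {\<xi>\<in>Q. \<eta> / b \<eta> k \<le> norm (rhat f \<xi>)}" for k a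
  \<comment> \<open>The support contains the frequency 0, so quotients by \<open>b \<eta> k\<close>
    never degenerate to division by 0.\<close>
  have pos: "0 < b \<eta> k" if "kernel a" "card (supp a) \<le> b \<eta> k" for k a
    using that red_0_in_supp[OF that(1)] by (metis card_gt_0_iff empty_iff finite_supp gr0I not_le)
  have "\<exists>a. \<forall>k. (kernel (a k) \<and> card (supp (a k)) \<le> b \<eta> k) \<and>
    (\<forall>\<xi>\<in>S k (a k). 1 - \<eta> / b \<eta> k \<le> a (Suc k) \<xi>)"
  proof (rule dependent_nat_choice)
    show "\<exists>a. kernel a \<and> card (supp a) \<le> b \<eta> 0" using C[rule_format, of 1 "{}" 0] by (auto simp: b_def)
  next
    fix a k assume a: "kernel a \<and> card (supp a) \<le> b \<eta> k"
    then have b0: "0 < b \<eta> k" using pos by blast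
    let ?L = "{\<xi>\<in>Q. \<eta> / b \<eta> k \<le> norm (rhat f \<xi>)}"
    have "card ?L \<le> 1 / (\<eta> / b \<eta> k)\<^sup>2"
      using card_large_spectrum_le[OF f, of "\<eta> / b \<eta> k"] \<eta> b0 by simp
    then have "card ?L \<le> nat \<lfloor>1 / (\<eta> / b \<eta> k)\<^sup>2\<rfloor>" by (simp add: le_nat_floor)
    moreover have "card ((\<lambda>\<xi>. - rot \<xi>) ` supp a) \<le> b \<eta> k"
      using a card_image_le[of "supp a" "\<lambda>\<xi>. - rot \<xi>"] by simp
    moreover have "card {(1, 0), (0, 1) :: int \<times> int} \<le> 2" by (simp add: card_insert_if)
    ultimately have "card (S k a) \<le> 2 * b \<eta> k + 2 + nat \<lfloor>1 / (\<eta> / b \<eta> k)\<^sup>2\<rfloor>"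
      unfolding S_def using a
        card_Un_le[of "supp a \<union> (\<lambda>\<xi>. - rot \<xi>) ` supp a \<union> {(1, 0), (0, 1)}" ?L]
        card_Un_le[of "supp a \<union> (\<lambda>\<xi>. - rot \<xi>) ` supp a" "{(1, 0), (0, 1)}"]
        card_Un_le[of "supp a" "(\<lambda>\<xi>. - rot \<xi>) ` supp a"] by linarith
    moreover have "finite (S k a)" by (simp add: S_def)
    moreover have "0 < \<eta> / b \<eta> k" using \<eta> b0 by simp
    ultimately show "\<exists>a'. (kernel a' \<and> card (supp a') \<le> b \<eta> (Suc k)) \<and> (\<forall>\<xi>\<in>S k a. 1 - \<eta> / b \<eta> k \<le> a' \<xi>)"
      using C[rule_format, of "\<eta> / b \<eta> k" "S k a"] by (simp add: b_def)
  qed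
  then obtain a where a: "\<And>k. kernel (a k)" "\<And>k. card (supp (a k)) \<le> b \<eta> k"
    "\<And>k \<xi>. \<xi> \<in> S k (a k) \<Longrightarrow> 1 - \<eta> / b \<eta> k \<le> a (Suc k) \<xi>" by blast
  have weak: "1 - \<eta> \<le> a (Suc k) \<xi>" if "\<xi> \<in> S k (a k)" for k \<xi>
  proof -
    have "0 < b \<eta> k" using pos[OF a(1,2)] .
    then have "1 \<le> real (b \<eta> k)" by linarith
    then have "\<eta> / b \<eta> k \<le> \<eta> / 1" using \<eta> by (intro divide_left_mono) auto
    then show ?thesis using a(3)[OF that] by simp
  qed
  show thesis
    by (rule that[of a]) (auto intro!: a(1,2) weak a(3) simp: S_def)
qed

lemma exists_kernel_large_lam:
  fixes C :: "nat \<Rightarrow> real \<Rightarrow> nat"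
  assumes C: "\<forall>s \<eta>. 0 < \<eta> \<longrightarrow> (\<forall>S. finite S \<longrightarrow> card S \<le> s \<longrightarrow>
      (\<exists>a. kernel a \<and> card (supp a) \<le> C s \<eta> \<and> (\<forall>\<xi>\<in>S. 1 - \<eta> \<le> a \<xi>)))"
    and f: "per f" "\<And>x. 0 \<le> f x" "\<And>x. f x \<le> 1"
    and \<theta>: "0 < \<theta>" "\<theta> < 1" and K: "0 < K" "1 \<le> \<theta>\<^sup>2 * real K"
  obtains w k where "k < K" "kernel w" "card (supp w) \<le> support_bound C (\<theta>\<^sup>2) (Suc k)"
    "(avg f) ^ 3 - 16 * \<theta> \<le> lam w f f f" "1 - \<theta>\<^sup>2 \<le> w (1, 0)" "1 - \<theta>\<^sup>2 \<le> w (0, 1)"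
proof -
  let ?b = "support_bound C (\<theta>\<^sup>2)"
  have af: "\<bar>f x\<bar> \<le> 1" for x using f(2,3)[of x] by simp
  have \<theta>2: "0 < \<theta>\<^sup>2" "\<theta>\<^sup>2 < 1" using \<theta> by (auto simp: power_less_one_iff)
  obtain a where ker: "\<And>k. kernel (a k)" and card: "\<And>k. card (supp (a k)) \<le> ?b k"
    and a: "\<And>k \<xi>. \<xi> \<in> supp (a k) \<Longrightarrow> 1 - \<theta>\<^sup>2 \<le> a (Suc k) \<xi>"
      "\<And>k \<xi>. \<xi> \<in> supp (a k) \<Longrightarrow> 1 - \<theta>\<^sup>2 \<le> a (Suc k) (- rot \<xi>)"
    and axes: "\<And>k. 1 - \<theta>\<^sup>2 \<le> a (Suc k) (1, 0)" "\<And>k. 1 - \<theta>\<^sup>2 \<le> a (Suc k) (0, 1)"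
    and spec: "\<And>k \<xi>. \<xi> \<in> Q \<Longrightarrow> \<theta>\<^sup>2 / ?b k \<le> norm (rhat f \<xi>) \<Longrightarrow> 1 - \<theta>\<^sup>2 / ?b k \<le> a (Suc k) \<xi>"
    using exists_kernel_sequence[OF C f(1) af \<theta>2(1)] by blast
  obtain k where k: "k < K" "avg (\<lambda>x. (smooth (a (Suc (Suc k))) f x - smooth (a k) f x)\<^sup>2) \<le> 4 * \<theta>\<^sup>2"
    using small_increment[where a = a, OF ker a(1) \<theta>2 f(1) af K] by blast
  \<comment> \<open>The kernels at \<open>k\<close>, \<open>k + 1\<close>, \<open>k + 2\<close> act
    as \<open>a\<close>, \<open>w\<close>, \<open>c\<close>.\<close>
  have "(avg f) ^ 3 - 16 * \<theta> \<le> lam (a (Suc k)) f f f"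
    using lam_lower_bound[where b = "real (?b (Suc k))" and a = "a k" and w = "a (Suc k)" and c = "a (Suc (Suc k))",
        OF ker ker ker f \<theta>(1) _ _ a(1) a(2) spec k(2)] \<theta>(2) card[of "Suc k"] by simp
  with k(1) ker card axes that show thesis by blast
qed

section \<open>Back from the torus to the grid\<close>

lemma exists_small_representative:
  "\<exists>m. int N dvd m - j \<and> (real_of_int m)\<^sup>2 \<le> real N ^ 2 * (norm (cis (2 * pi * of_int j / N) - 1))\<^sup>2"
proof -
  \<comment> \<open>The representative of \<open>j\<close> nearest to 0, so that \<open>t\<close>
    lies in the range of \<open>norm_cis_minus_1_ge\<close>.\<close>
  define m where "m = j - int N * round (real_of_int j / N)"
  define t where "t = real_of_int j / N - of_int (round (real_of_int j / N))"
  have mt: "real_of_int m = N * t" using N_pos by (simp add: m_def t_def field_simps)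
  have "\<bar>t\<bar> \<le> 1 / 2" using of_int_round_abs_le[of "real_of_int j / N"] by (simp add: t_def abs_minus_commute)
  then have "t\<^sup>2 \<le> (norm (cis (2 * pi * t) - 1))\<^sup>2" by (rule norm_cis_minus_1_ge)
  also have "cis (2 * pi * t) = cis (2 * pi * of_int j / N)"
  proof -
    have "2 * pi * of_int j / N = 2 * pi * t + 2 * pi * of_int (round (real_of_int j / N))"
      by (simp add: t_def algebra_simps)
    then show ?thesis by (simp add: cis_mult[symmetric] cis_multiple_2pi)
  qed
  finally have "(real_of_int m)\<^sup>2 \<le> real N ^ 2 * (norm (cis (2 * pi * of_int j / N) - 1))\<^sup>2"
    by (simp add: mt power_mult_distrib mult_left_mono)
  moreover have "int N dvd m - j" by (simp add: m_def)
  ultimately show ?thesis by blast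
qed

text \<open>Otherwise all short nonzero differences have counts below \<open>c\<close>, the zero
  difference has little mass, and Chebyshev's inequality with the characters of the two unit vectors
  bounds the mass of the long differences; together this contradicts the lower bound on
  \<open>lam w f f f\<close>.\<close>

lemma exists_popular_difference:
  fixes \<delta> \<theta> c :: real
  assumes w: "kernel w" "1 - \<theta>\<^sup>2 \<le> w (1, 0)" "1 - \<theta>\<^sup>2 \<le> w (0, 1)"
    and f: "\<And>x. 0 \<le> f x" "\<And>x. f x \<le> 1" and "per f"
    and \<delta>: "0 < \<delta>" and c: "0 \<le> c" "c + card (supp w) / real N ^ 2 + 4 * \<theta>\<^sup>2 / \<delta>\<^sup>2 < lam w f f f"
  shows "\<exists>m n. (m, n) \<noteq> (0, 0) \<and> \<bar>real_of_int m\<bar> \<le> \<delta> * N \<and> \<bar>real_of_int n\<bar> \<le> \<delta> * N \<and>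
    c \<le> avg (\<lambda>x. f x * f (x + (m, n)) * f (x + (- n, m)))"
proof (rule ccontr)
  assume neg: "\<not> ?thesis"
  let ?F = "\<lambda>d. avg (\<lambda>x. f x * f (x + d) * f (x + rot d))"
  let ?e1 = "\<lambda>d. (norm (e (1, 0) d - 1))\<^sup>2" and ?e2 = "\<lambda>d. (norm (e (0, 1) d - 1))\<^sup>2"
  have F: "?F d \<le> 1" for d
  proof -
    have "?F d \<le> avg (\<lambda>x. 1)" by (intro avg_mono mult_le_one mult_nonneg_nonneg f)
    then show ?thesis by simp
  qed
  \<comment> \<open>A difference is zero, long or short. For a long one the last summand is at least
    1, while \<open>?F d \<le> 1\<close>. For a short one \<open>d\<close> may be exchanged for its
    short representative, since the count depends only on the class of \<open>d\<close>.\<close>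
  have main: "?F d \<le> c + of_bool (d = red 0) + (?e1 d + ?e2 d) / \<delta>\<^sup>2" if "d \<in> Q" for d
  proof -
    obtain m where m: "int N dvd m - fst d" "(real_of_int m)\<^sup>2 \<le> real N ^ 2 * ?e1 d"
      using exists_small_representative[of "fst d"] by (auto simp: e_def)
    obtain n where n: "int N dvd n - snd d" "(real_of_int n)\<^sup>2 \<le> real N ^ 2 * ?e2 d"
      using exists_small_representative[of "snd d"] by (auto simp: e_def)
    have red: "red (m, n) = red d" using m n by (simp add: red_eq_iff)
    have far: "\<delta>\<^sup>2 \<le> E" if "\<not> \<bar>real_of_int j\<bar> \<le> \<delta> * N" "(real_of_int j)\<^sup>2 \<le> real N ^ 2 * E" for j E
    proof -
      have "(\<delta> * N)\<^sup>2 \<le> \<bar>real_of_int j\<bar>\<^sup>2" using that \<delta> by (intro power_mono) auto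
      then have "real N ^ 2 * \<delta>\<^sup>2 \<le> real N ^ 2 * E" using that(2) by (simp add: power_mult_distrib mult.commute)
      then show ?thesis using N_pos by simp
    qed
    consider "d = red 0" | "\<not> \<bar>real_of_int m\<bar> \<le> \<delta> * N" | "\<not> \<bar>real_of_int n\<bar> \<le> \<delta> * N"
      | "d \<noteq> red 0" "\<bar>real_of_int m\<bar> \<le> \<delta> * N" "\<bar>real_of_int n\<bar> \<le> \<delta> * N" by blast
    then show ?thesis
    proof cases
      case 1
      have "0 \<le> (?e1 d + ?e2 d) / \<delta>\<^sup>2" by simp
      moreover have "of_bool (d = red 0) = (1 :: real)" using 1 by simp
      ultimately show ?thesis using F[of d] c(1) by linarith
    next
      case 2
      have "1 \<le> (?e1 d + ?e2 d) / \<delta>\<^sup>2"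
        using far[OF 2 m(2)] \<delta> by (simp add: add_increasing2)
      moreover have "0 \<le> (of_bool (d = red 0) :: real)" by simp
      ultimately show ?thesis using F[of d] c(1) by linarith
    next
      case 3
      have "1 \<le> (?e1 d + ?e2 d) / \<delta>\<^sup>2"
        using far[OF 3 n(2)] \<delta> by (simp add: add_increasing)
      moreover have "0 \<le> (of_bool (d = red 0) :: real)" by simp
      ultimately show ?thesis using F[of d] c(1) by linarith
    next
      case 4
      have "(m, n) \<noteq> (0, 0)"
        using red red_id[OF \<open>d \<in> Q\<close>] 4(1) by (auto simp: zero_prod_def)
      with neg 4 have "?F (m, n) < c" by (force simp: rot_def)
      moreover have "?F (m, n) = ?F d"
      proof -
        have "red (rot (m, n)) = red (rot d)" using red by (metis red_rot)
        then have "f (x + (m, n)) = f (x + d)" "f (x + rot (m, n)) = f (x + rot d)" for x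
          using perD[OF \<open>per f\<close>] red by (metis red_add_right)+
        then show ?thesis by simp
      qed
      moreover have "0 \<le> (?e1 d + ?e2 d) / \<delta>\<^sup>2" by simp
      ultimately show ?thesis by (simp add: add_increasing2)
    qed
  qed
  have "lam w f f f \<le> avg (\<lambda>d. nu w d * c + nu w 0 * of_bool (d = red 0)
      + 1 / \<delta>\<^sup>2 * (nu w d * ?e1 d + nu w d * ?e2 d))"
    unfolding lam_def
  proof (rule avg_mono)
    fix d assume "d \<in> Q"
    have expand: "p * (c + q + (x + y) / D) = p * c + p * q + 1 / D * (p * x + p * y)" for p q x y D :: real
      by (simp add: algebra_simps add_divide_distrib)
    have "nu w d * of_bool (d = red 0) = nu w 0 * of_bool (d = red 0)"
      using per_red[OF per_nu, of w 0] by simp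
    moreover have "nu w d * ?F d \<le> nu w d * (c + of_bool (d = red 0) + (?e1 d + ?e2 d) / \<delta>\<^sup>2)"
      using main[OF \<open>d \<in> Q\<close>] kernelD(5)[OF w(1)] by (intro mult_left_mono) auto
    ultimately show "nu w d * ?F d \<le> nu w d * c + nu w 0 * of_bool (d = red 0)
      + 1 / \<delta>\<^sup>2 * (nu w d * ?e1 d + nu w d * ?e2 d)"
      by (simp only: expand)
  qed
  also have "\<dots> = c + nu w 0 / real N ^ 2 + 1 / \<delta>\<^sup>2 * ((2 - 2 * w (1, 0)) + (2 - 2 * w (0, 1)))"
  proof -
    have "avg (\<lambda>d. of_bool (d = red 0)) = 1 / real N ^ 2"
      by (simp add: avg_def of_bool_def)
    then show ?thesis
      by (simp only: avg_add avg_cmult avg_nu_const[OF w(1)] avg_nu_dist[OF w(1)]) simp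
  qed
  \<comment> \<open>Each unit vector contributes at most
    \<open>2 * \<theta>\<^sup>2\<close>.\<close>
  also have "\<dots> \<le> c + card (supp w) / real N ^ 2 + 1 / \<delta>\<^sup>2 * (4 * \<theta>\<^sup>2)"
    using nu_0_le[OF w(1)] w(2,3)
    by (intro add_mono mult_left_mono divide_right_mono order_refl) auto
  finally show False using c(2) by simp
qed

lemma card_translate_exits_le:
  "card {i \<in> {1..int N}. i + t \<notin> {1..int N}} \<le> nat \<bar>t\<bar>"
proof (cases "0 \<le> t")
  case True
  then have "{i \<in> {1..int N}. i + t \<notin> {1..int N}} \<subseteq> {int N - t + 1..int N}" by auto
  from card_mono[OF _ this] show ?thesis using True by simp
next
  case False
  then have "{i \<in> {1..int N}. i + t \<notin> {1..int N}} \<subseteq> {1..- t}" by auto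
  from card_mono[OF _ this] show ?thesis using False by simp
qed

text \<open>A triple modulo \<open>N\<close> that is not one in the grid has a vertex outside the
  grid, so one of the coordinate shifts \<open>m\<close>, \<open>n\<close>, \<open>- n\<close>,
  \<open>m\<close> leaves the interval; each of the four excludes at most
  \<open>\<delta> * N ^ 2\<close> base points.\<close>

lemma card_triples_ge:
  fixes \<delta> :: real
  assumes A: "A \<subseteq> Q" and \<delta>: "\<bar>real_of_int m\<bar> \<le> \<delta> * N" "\<bar>real_of_int n\<bar> \<le> \<delta> * N"
  defines "f \<equiv> \<lambda>x. of_bool (red x \<in> A) :: real"
  shows "(avg (\<lambda>x. f x * f (x + (m, n)) * f (x + (- n, m))) - 4 * \<delta>) * real N ^ 2
    \<le> card (A \<inter> set_minus_vec A (m, n) \<inter> set_minus_vec A (- n, m))"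
proof -
  let ?I = "{1..int N}"
  let ?T = "A \<inter> set_minus_vec A (m, n) \<inter> set_minus_vec A (- n, m)"
  define B where "B t = {i \<in> ?I. i + t \<notin> ?I}" for t
  have finite_B: "finite (B t)" for t unfolding B_def by (rule finite_subset[of _ ?I]) auto
  let ?G = "{x\<in>Q. red x \<in> A \<and> red (x + (m, n)) \<in> A \<and> red (x + (- n, m)) \<in> A}"
  have G: "avg (\<lambda>x. f x * f (x + (m, n)) * f (x + (- n, m))) * real N ^ 2 = card ?G"
    using N_pos by (simp add: avg_def f_def Int_def conj_assoc flip: of_bool_conj)
  have "?G \<subseteq> ?T \<union> (B m \<times> ?I \<union> ?I \<times> B n \<union> B (- n) \<times> ?I \<union> ?I \<times> B m)"
  proof
    fix x assume x: "x \<in> ?G"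
    show "x \<in> ?T \<union> (B m \<times> ?I \<union> ?I \<times> B n \<union> B (- n) \<times> ?I \<union> ?I \<times> B m)"
    proof (cases "x + (m, n) \<in> Q \<and> x + (- n, m) \<in> Q")
      case True
      then show ?thesis using x by (auto simp: red_id mem_set_minus_vec_iff)
    next
      case False
      then show ?thesis using x by (cases x) (auto simp: Q_def B_def)
    qed
  qed
  then have "card ?G \<le> card (?T \<union> (B m \<times> ?I \<union> ?I \<times> B n \<union> B (- n) \<times> ?I \<union> ?I \<times> B m))"
    using finite_subset[OF A finite_Q] finite_B by (intro card_mono) auto
  also have "\<dots> \<le> card ?T + (card (B m \<times> ?I) + card (?I \<times> B n) + card (B (- n) \<times> ?I) + card (?I \<times> B m))"
    by (intro order_trans[OF card_Un_le] add_mono order_refl)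
  finally have "card ?G \<le> card ?T + (card (B m) * N + N * card (B n) + card (B (- n)) * N + N * card (B m))"
    by (simp add: card_cartesian_product)
  from of_nat_mono[OF this, where 'a = real]
  have "card ?G \<le> card ?T + (real (card (B m)) * N + real (card (B n)) * N
      + real (card (B (- n))) * N + real (card (B m)) * N)"
    by (simp add: mult.commute)
  moreover have "real (card (B t)) * N \<le> \<delta> * N * N" if "\<bar>real_of_int t\<bar> \<le> \<delta> * N" for t
    using card_translate_exits_le[of t] that unfolding B_def by (intro mult_right_mono) linarith+
  from this[of m] this[of n] this[of "- n"] \<delta> have "real (card (B m)) * N \<le> \<delta> * N * N"
    "real (card (B n)) * N \<le> \<delta> * N * N" "real (card (B (- n))) * N \<le> \<delta> * N * N" by auto
  ultimately have "real (card ?G) \<le> card ?T + 4 * (\<delta> * N * N)" by linarith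
  then show ?thesis using G by (simp add: algebra_simps power2_eq_square)
qed

end

section \<open>Choice of parameters and assembly\<close>

theorem theorem1:
  fixes \<epsilon> :: real
  assumes "0 < \<epsilon>" and "\<epsilon> \<le> 1"
  shows "\<exists>N\<^sub>0::nat. N\<^sub>0 > 0 \<and>
    (\<forall>N\<ge>N\<^sub>0. \<forall>A :: (int \<times> int) set. A \<subseteq> {1..int N} \<times> {1..int N} \<longrightarrow>
      (\<exists>m n :: int. (m, n) \<noteq> (0, 0) \<and>
        real (card (A \<inter> set_minus_vec A (m, n) \<inter> set_minus_vec A (-n, m)))
          \<ge> (grid_density N A ^ 3 - \<epsilon>) * real N ^ 2))"
proof -
  \<comment> \<open>The losses are \<open>16 * \<theta>\<close> from \<open>lam_lower_bound\<close>,
    \<open>\<delta>\<close> from the zero difference and \<open>4 * \<theta>\<close> from long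
    differences, together below \<open>22 * \<delta>\<close>; wrap-around costs
    \<open>4 * \<delta>\<close> more. Taking \<open>\<theta> = \<delta>\<^sup>2\<close> makes
    \<open>4 * \<theta>\<^sup>2 / \<delta>\<^sup>2\<close> equal to
    \<open>4 * \<theta>\<close>.\<close>
  define \<delta> where "\<delta> = \<epsilon> / 26"
  define \<theta> where "\<theta> = \<delta>\<^sup>2"
  have \<delta>: "0 < \<delta>" "\<delta> < 1" using assms by (auto simp: \<delta>_def)
  then have \<theta>: "0 < \<theta>" "\<theta> < 1" by (auto simp: \<theta>_def power_less_one_iff)
  have "\<theta> \<le> \<delta>" using \<delta> by (simp add: \<theta>_def power2_eq_square mult_left_le_one_le)
  from exists_kernel obtain C :: "nat \<Rightarrow> real \<Rightarrow> nat" where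
    C: "\<forall>s \<eta>. 0 < \<eta> \<longrightarrow> (\<forall>N S. 0 < N \<longrightarrow> finite S \<longrightarrow> card S \<le> s \<longrightarrow>
      (\<exists>a. torus.kernel N a \<and> card (torus.supp N a) \<le> C s \<eta> \<and> (\<forall>\<xi>\<in>S. 1 - \<eta> \<le> a \<xi>)))"
    by (rule exE)
  obtain K :: nat where "1 / \<theta>\<^sup>2 < real K" using reals_Archimedean2 by blast
  then have K: "1 \<le> \<theta>\<^sup>2 * real K" using \<theta> by (simp add: field_simps)
  then have K0: "0 < K" by (cases K) auto
  \<comment> \<open>The scale \<open>k\<close> will depend on \<open>N\<close> and \<open>A\<close>,
    so the sum over all scales serves as a uniform bound. The choice of \<open>N\<^sub>0\<close>
    then keeps the mass at the zero difference, at most \<open>B / N ^ 2\<close>, below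
    \<open>\<delta>\<close>.\<close>
  define B where "B = (\<Sum>k<K. support_bound C (\<theta>\<^sup>2) (Suc k))"
  obtain N\<^sub>0 :: nat where N\<^sub>0: "real B / \<delta> < real N\<^sub>0" using reals_Archimedean2 by blast
  have "\<exists>m n :: int. (m, n) \<noteq> (0, 0) \<and>
        real (card (A \<inter> set_minus_vec A (m, n) \<inter> set_minus_vec A (-n, m)))
          \<ge> (grid_density N A ^ 3 - \<epsilon>) * real N ^ 2"
    if N: "N \<ge> max 1 N\<^sub>0" and A: "A \<subseteq> {1..int N} \<times> {1..int N}" for N A
  \<comment> \<open>If the required bound is nonpositive any nonzero vector will do; otherwise the
    target \<open>(avg f) ^ 3 - 22 * \<delta>\<close> is nonnegative, as
    \<open>exists_popular_difference\<close> demands.\<close>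
  proof (cases "grid_density N A ^ 3 \<le> \<epsilon>")
    case True
    then have "(grid_density N A ^ 3 - \<epsilon>) * real N ^ 2 \<le> 0"
      by (simp add: mult_nonpos_nonneg)
    then show ?thesis by (intro exI[of _ 1] exI[of _ 0]) (auto intro: order_trans)
  next
    case False
    interpret torus N using N by unfold_locales simp
    have AQ: "A \<subseteq> Q" using A by (simp add: Q_def)
    define f where "f = (\<lambda>x. of_bool (red x \<in> A) :: real)"
    have f: "per f" "\<And>x. 0 \<le> f x" "\<And>x. f x \<le> 1" by (auto simp: f_def per_def)
    have "(\<Sum>x\<in>Q. f x) = card A"
    proof -
      have "(\<Sum>x\<in>Q. f x) = (\<Sum>x\<in>Q. if x \<in> A then 1 else 0)"
        by (intro sum.cong) (auto simp: f_def red_id)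
      then show ?thesis using AQ by (simp add: sum.inter_restrict[symmetric] inf_absorb2)
    qed
    then have avg_f: "avg f = grid_density N A" by (simp add: avg_def grid_density_def)
    obtain w k where w: "k < K" "kernel w" "card (supp w) \<le> support_bound C (\<theta>\<^sup>2) (Suc k)"
      "(avg f) ^ 3 - 16 * \<theta> \<le> lam w f f f" "1 - \<theta>\<^sup>2 \<le> w (1, 0)" "1 - \<theta>\<^sup>2 \<le> w (0, 1)"
    proof (rule exists_kernel_large_lam[where C = C and f = f and \<theta> = \<theta> and K = K])
      show "\<forall>s \<eta>. 0 < \<eta> \<longrightarrow> (\<forall>S. finite S \<longrightarrow> card S \<le> s \<longrightarrow>
          (\<exists>a. kernel a \<and> card (supp a) \<le> C s \<eta> \<and> (\<forall>\<xi>\<in>S. 1 - \<eta> \<le> a \<xi>)))"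
        by (intro allI impI C[rule_format] N_pos)
    qed (use f \<theta> K0 K in auto)
    have "support_bound C (\<theta>\<^sup>2) (Suc k) \<le> B"
      unfolding B_def using w(1) by (intro member_le_sum) auto
    then have "real (card (supp w)) \<le> B" using w(3) by simp
    also have "\<dots> < \<delta> * real N\<^sub>0" using N\<^sub>0 \<delta> by (simp add: field_simps)
    also have "\<dots> \<le> \<delta> * real N ^ 2"
    proof -
      have "real N\<^sub>0 * 1 \<le> real N * real N" using N by (intro mult_mono) auto
      then show ?thesis using \<delta> by (simp add: power2_eq_square)
    qed
    finally have mass: "card (supp w) / real N ^ 2 < \<delta>"
      using N_pos by (simp add: divide_less_eq)
    have "4 * \<theta>\<^sup>2 / \<delta>\<^sup>2 = 4 * \<theta>" using \<delta> by (simp add: \<theta>_def power2_eq_square)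
    then have "(avg f) ^ 3 - 22 * \<delta> + card (supp w) / real N ^ 2 + 4 * \<theta>\<^sup>2 / \<delta>\<^sup>2 < lam w f f f"
      using mass w(4) \<open>\<theta> \<le> \<delta>\<close> \<delta>(1) by linarith
    moreover have "0 \<le> (avg f) ^ 3 - 22 * \<delta>" using False assms by (simp add: avg_f \<delta>_def)
    ultimately obtain m n where mn: "(m, n) \<noteq> (0, 0)" "\<bar>real_of_int m\<bar> \<le> \<delta> * N" "\<bar>real_of_int n\<bar> \<le> \<delta> * N"
      "(avg f) ^ 3 - 22 * \<delta> \<le> avg (\<lambda>x. f x * f (x + (m, n)) * f (x + (- n, m)))"
      using exists_popular_difference[OF w(2,5,6) f(2,3,1) \<delta>(1)] by blast
    have "(grid_density N A ^ 3 - \<epsilon>) * real N ^ 2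
        \<le> (avg (\<lambda>x. f x * f (x + (m, n)) * f (x + (- n, m))) - 4 * \<delta>) * real N ^ 2"
      using mn(4) by (intro mult_right_mono) (auto simp: avg_f \<delta>_def)
    also have "\<dots> \<le> card (A \<inter> set_minus_vec A (m, n) \<inter> set_minus_vec A (- n, m))"
      using card_triples_ge[OF AQ mn(2,3)] by (simp add: f_def)
    finally show ?thesis using mn(1) by blast
  qed
  then show ?thesis by (intro exI[of _ "max 1 N\<^sub>0"]) auto
qed

end
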